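(* Fix $L>0$ and $\Omega\subset[-L,L]\times\mathbb Z$. Then there exist $\nu\in(0,1]$, operators $H_\pm$ satisfying Assumption 1 (with this $\nu$) for a gap $\mathcal G$ containing $0$, and an operator $H_e$ satisfying Assumption 2 (with this $\nu$, $\Omega$ and $H_\pm$), such that $0\notin\Sigma(H_e)$.
   Context: Take $d=2$. On $\mathbb{Z}^2$ use $|\mathbf x|=|x_1|+|x_2|$ and $B_r(\mathbf x)=\{\mathbf y\in\mathbb{Z}^2:|\mathbf y-\mathbf x|\le r\}$. For an operator $H$ on $\ell^2(\mathbb{Z}^2,\mathbb{C}^d)$, $H(\mathbf x,\mathbf y)$ denotes its kernel and $\Sigma(H)$ its spectrum. For $\nu\in(0,1]$, $H$ is called short-range if it is bounded, selfadjoint, and $|H(\mathbf x,\mathbf y)|\le\nu^{-1}e^{-2\nu|\mathbf x-\mathbf y|}$ for all $\mathbf x,\mathbf y$. For $\lambda\notin\Sigma(H)$ let $P_\lambda(H)=\mathbb 1_{(-\infty,\lambda)}(H)$, let $\Lambda_1,\Lambda_2$ be multiplication by the indicator functions of $\mathbb N\times\mathbb Z$ and $\mathbb Z\times\mathbb N$, and $\sigma(H,\lambda)=-2\pi i\operatorname{Tr}\big(P_\lambda(H)[[P_\lambda(H),\Lambda_1],[P_\lambda(H),\Lambda_2]]\big)$, constant in $\lambda$ on intervals $\mathcal G\subset\Sigma(H)^c$ (written $\sigma(H,\mathcal G)$). Assumption 1: $H_\pm$ are short-range, $\mathcal G$ is an interval contained in $\Sigma(H_+)^c\cap\Sigma(H_-)^c$,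 and $\sigma(H_+,\mathcal G)\ne\sigma(H_-,\mathcal G)$. With $\partial\Omega=\{\mathbf x\in\Omega:B_1(\mathbf x)\not\subset\Omega\}\cup\{\mathbf x\in\Omega^c:B_1(\mathbf x)\not\subset\Omega^c\}$, Assumption 2: $H_e$ is short-range and $E:=H_e-\mathbb 1_\Omega H_+\mathbb 1_\Omega-\mathbb 1_{\Omega^c}H_-\mathbb 1_{\Omega^c}$ satisfies $|E(\mathbf x,\mathbf y)|\le\nu^{-1}e^{-2\nu d(\mathbf x,\partial\Omega)}$ for all $\mathbf x,\mathbf y$. *)

theory Defs
  imports "HOL-Analysis.Analysis"
begin

type_synonym site = "int \<times> int"
type_synonym wave = "site \<Rightarrow> complex^2"
type_synonym kernel = "site \<Rightarrow> site \<Rightarrow> complex^2^2"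

definition l1dist :: "site \<Rightarrow> site \<Rightarrow> nat" where
  "l1dist x y = nat (\<bar>fst x - fst y\<bar> + \<bar>snd x - snd y\<bar>)"

definition l2 :: "wave set" where
  "l2 = {u. (\<lambda>x. (norm (u x))^2) summable_on UNIV}"

definition l2norm :: "wave \<Rightarrow> real" where
  "l2norm u = sqrt (\<Sum>\<^sub>\<infinity>x. (norm (u x))^2)"

definition l2inner :: "wave \<Rightarrow> wave \<Rightarrow> complex" where
  "l2inner u v = (\<Sum>\<^sub>\<infinity>x. \<Sum>i\<in>UNIV. cnj (u x $ i) * v x $ i)"

definition kapp :: "kernel \<Rightarrow> wave \<Rightarrow> wave" where
  "kapp K u = (\<lambda>x. \<Sum>\<^sub>\<infinity>y. K x y *v u y)"

definition bounded_kernel :: "kernel \<Rightarrow> bool" where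
  "bounded_kernel K \<longleftrightarrow> (\<exists>C. \<forall>u\<in>l2. kapp K u \<in> l2 \<and> l2norm (kapp K u) \<le> C * l2norm u)"

definition selfadjoint_kernel :: "kernel \<Rightarrow> bool" where
  "selfadjoint_kernel K \<longleftrightarrow> (\<forall>x y. K y x = (\<chi> i j. cnj (K x y $ j $ i)))"

definition short_range :: "real \<Rightarrow> kernel \<Rightarrow> bool" where
  "short_range \<nu> K \<longleftrightarrow> bounded_kernel K \<and> selfadjoint_kernel K \<and>
     (\<forall>x y. norm (K x y) \<le> (1/\<nu>) * exp (- 2 * \<nu> * real (l1dist x y)))"

definition in_resolvent :: "kernel \<Rightarrow> complex \<Rightarrow> bool" where
  "in_resolvent K z \<longleftrightarrow> (\<exists>G :: wave \<Rightarrow> wave. (\<exists>C. \<forall>u\<in>l2. G u \<in> l2 \<and> l2norm (G u) \<le> C * l2norm u) \<and>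
      (\<forall>u\<in>l2. (\<lambda>x. kapp K (G u) x - z *s G u x) = u) \<and>
      (\<forall>u\<in>l2. G (\<lambda>x. kapp K u x - z *s u x) = u))"

definition spectrum_k :: "kernel \<Rightarrow> complex set" where
  "spectrum_k K = {z. \<not> in_resolvent K z}"

text \<open>Characterisation of the spectral projection 1_{(-\<infinity>,\<lambda>)}(H) (for \<lambda> not in the spectrum):
  the orthogonal projection (extended by 0 off l^2) commuting with H with H \<le> \<lambda> on its range and
  H \<ge> \<lambda> on its orthogonal complement.\<close>
definition is_spec_proj :: "kernel \<Rightarrow> real \<Rightarrow> (wave \<Rightarrow> wave) \<Rightarrow> bool" where
  "is_spec_proj K lam P \<longleftrightarrow>
     (\<forall>u. u \<notin> l2 \<longrightarrow> P u = (\<lambda>x. 0)) \<and> (\<forall>u\<in>l2. P u \<in> l2) \<and>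
     (\<forall>u\<in>l2. P (P u) = P u) \<and>
     (\<forall>u\<in>l2. \<forall>v\<in>l2. l2inner (P u) v = l2inner u (P v)) \<and>
     (\<forall>u\<in>l2. P (kapp K u) = kapp K (P u)) \<and>
     (\<forall>u\<in>l2. Re (l2inner (P u) (kapp K (P u))) \<le> lam * (l2norm (P u))^2) \<and>
     (\<forall>u\<in>l2. Re (l2inner (\<lambda>x. u x - P u x) (kapp K (\<lambda>x. u x - P u x)))
                 \<ge> lam * (l2norm (\<lambda>x. u x - P u x))^2)"

definition spec_proj :: "kernel \<Rightarrow> real \<Rightarrow> wave \<Rightarrow> wave" where
  "spec_proj K lam = (THE P. is_spec_proj K lam P)"

definition comm :: "(wave \<Rightarrow> wave) \<Rightarrow> (wave \<Rightarrow> wave) \<Rightarrow> wave \<Rightarrow> wave" where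
  "comm A B = (\<lambda>u x. A (B u) x - B (A u) x)"

definition Lam1 :: "wave \<Rightarrow> wave" where
  "Lam1 u = (\<lambda>x. if fst x \<ge> 0 then u x else 0)"
definition Lam2 :: "wave \<Rightarrow> wave" where
  "Lam2 u = (\<lambda>x. if snd x \<ge> 0 then u x else 0)"

definition delta :: "site \<Rightarrow> 2 \<Rightarrow> wave" where
  "delta x i = (\<lambda>y. if y = x then axis i 1 else 0)"

definition Tr :: "(wave \<Rightarrow> wave) \<Rightarrow> complex" where
  "Tr A = (\<Sum>\<^sub>\<infinity>x. \<Sum>i\<in>UNIV. (A (delta x i) x) $ i)"

definition sigma :: "kernel \<Rightarrow> real \<Rightarrow> complex" where
  "sigma K lam = (let P = spec_proj K lam in
     - 2 * of_real pi * \<i> * Tr (\<lambda>u. P (comm (comm P Lam1) (comm P Lam2) u)))"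

definition assumption1 :: "real \<Rightarrow> kernel \<Rightarrow> kernel \<Rightarrow> real set \<Rightarrow> bool" where
  "assumption1 \<nu> Hp Hm G \<longleftrightarrow> short_range \<nu> Hp \<and> short_range \<nu> Hm \<and> is_interval G \<and>
     (\<forall>lam\<in>G. of_real lam \<notin> spectrum_k Hp \<and> of_real lam \<notin> spectrum_k Hm) \<and>
     (\<forall>lam\<in>G. sigma Hp lam \<noteq> sigma Hm lam)"

definition boundary :: "site set \<Rightarrow> site set" where
  "boundary \<Omega> = {x\<in>\<Omega>. \<exists>y. l1dist x y \<le> 1 \<and> y \<notin> \<Omega>} \<union> {x. x \<notin> \<Omega> \<and> (\<exists>y. l1dist x y \<le> 1 \<and> y \<in> \<Omega>)}"

text \<open>The bound nu^{-1} exp(-2 nu d(x,S)), with d(x,{}) = +infinity (bound 0).\<close>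
definition dist_bound :: "real \<Rightarrow> site \<Rightarrow> site set \<Rightarrow> real" where
  "dist_bound \<nu> x S = (if S = {} then 0 else (1/\<nu>) * exp (- 2 * \<nu> * real (INF z\<in>S. l1dist x z)))"

definition edge_error :: "site set \<Rightarrow> kernel \<Rightarrow> kernel \<Rightarrow> kernel \<Rightarrow> kernel" where
  "edge_error \<Omega> Hp Hm He = (\<lambda>x y. He x y
      - (if x \<in> \<Omega> \<and> y \<in> \<Omega> then Hp x y else 0)
      - (if x \<notin> \<Omega> \<and> y \<notin> \<Omega> then Hm x y else 0))"

definition assumption2 :: "real \<Rightarrow> site set \<Rightarrow> kernel \<Rightarrow> kernel \<Rightarrow> kernel \<Rightarrow> bool" where
  "assumption2 \<nu> \<Omega> Hp Hm He \<longleftrightarrow> short_range \<nu> He \<and>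
     (\<forall>x y. norm (edge_error \<Omega> Hp Hm He x y) \<le> dist_bound \<nu> x (boundary \<Omega>))"

end

theory Submission
  imports Defs "HOL-Analysis.Generalised_Binomial_Theorem"
begin

text \<open>Since \<open>\<Omega>\<close> lies in a strip, every point of \<open>\<Omega>\<close> is at bounded distance from its boundary, so for small \<open>\<nu>\<close>
  Assumption 2 does not constrain the edge operator inside \<open>\<Omega>\<close>, and one may take \<open>H\<^sub>e = H\<^sub>- = 1\<close>. It remains
  to exhibit a short-range operator \<open>H\<^sub>+\<close> with a gap at \<open>0\<close> and \<open>\<sigma> \<noteq> 0\<close>. We take \<open>H\<^sub>+ = 1 - 2 P\<close> for a
  translation-invariant projection \<open>P\<close> whose symbol is \<open>(1 - n \<cdot> \<tau>) / 2\<close> with the Pauli matrices \<open>\<tau>\<close> and \<open>n\<close> the normalisation of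
  \<open>(cos k1, cos k2, sin k1 sin k2)\<close>. Symbols are treated through their Fourier coefficients, which form a
  commutative convolution ring with two derivations and an involution. Translation invariance turns
  the trace into the zero mode of \<open>tr P [D1 P, D2 P]\<close>; for the above \<open>n\<close> this is a nonzero multiple of a sum
  \<open>a\<^sup>2 + b\<^sup>2\<close> with \<open>a\<close>, \<open>b\<close> self-adjoint and \<open>a \<noteq> 0\<close>, and the zero mode of \<open>a\<^sup>2\<close> is the squared \<open>l2\<close> norm of \<open>a\<close>.\<close>

section \<open>Convolution of summable families\<close>

text \<open>Normalising a vector field on the torus calls for an inverse square root whose Fourier
  coefficients decay exponentially. For a general gapped symbol that is a statement of Wiener type;
  here the vector is chosen so that its squared length
  \<open>1 + cos\<^sup>2 k1 cos\<^sup>2 k2\<close> stays within a factor 2 and a binomial series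
  around its mean converges in a weighted l1 norm. The same norm supplies the pointwise decay that
  short-range operators need.

  Flatness stands in for functional calculus: \<open>1 - 2 P\<close> squares to the identity, hence
  inverts itself at energy 0, and its eigenvalues -1 and 1 single out the spectral projection among
  all maps with the required order properties.

  The Chern number is never evaluated as an integer. Since the identity has \<sigma> equal to 0, the
  two phases differ as soon as one zero mode is nonzero, and a curvature of one sign gives this
  through Parseval. Working with coefficients instead of functions on the torus makes operator
  composition, products of symbols and the trace formula all statements about convolution.\<close>

lemma summable_on_le:
  fixes f g :: "'a \<Rightarrow> real"
  assumes "g summable_on A" "\<And>x. x \<in> A \<Longrightarrow> 0 \<le> f x" "\<And>x. x \<in> A \<Longrightarrow> f x \<le> g x"
  shows "f summable_on A"
  using assms by (intro summable_on_comparison_test[of g A f]) auto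

lemma norm_le_infsum_norm:
  fixes f :: "'a \<Rightarrow> 'b::real_normed_vector"
  assumes "(\<lambda>x. norm (f x)) summable_on UNIV"
  shows "norm (f x) \<le> (\<Sum>\<^sub>\<infinity>y. norm (f y))"
  using finite_sum_le_infsum[OF assms, of "{x}"] by simp

lemma summable_on_times_nonneg:
  fixes f :: "'a \<Rightarrow> real" and g :: "'b \<Rightarrow> real"
  assumes f: "f summable_on A" "\<And>x. x \<in> A \<Longrightarrow> 0 \<le> f x" and g: "g summable_on B" "\<And>x. x \<in> B \<Longrightarrow> 0 \<le> g x"
  shows "(\<lambda>(x,y). f x * g y) summable_on (A \<times> B)"
proof (rule summable_on_SigmaI[where g="\<lambda>x. f x * infsum g B"])
  show "((\<lambda>y. case (x, y) of (x, y) \<Rightarrow> f x * g y) has_sum f x * infsum g B) B" if "x \<in> A" for x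
    using has_sum_cmult_right[OF has_sum_infsum[OF g(1)]] by simp
  show "(\<lambda>x. f x * infsum g B) summable_on A" by (rule summable_on_cmult_left[OF f(1)])
qed (use f g in auto)

lemma bij_diff_swap: "bij_betw (\<lambda>(x,y). (y, x - y)) UNIV (UNIV :: ('g::ab_group_add \<times> 'g) set)"
  by (rule bij_betwI[where g="\<lambda>(y,z). (y+z, y)"]) auto

text \<open>The shear sending \<open>(x,y)\<close> to \<open>(y, x - y)\<close> turns the
  convolution summand into a product, so summability over pairs is inherited from the product
  family.\<close>

lemma summable_on_conv_nonneg:
  fixes f g :: "'g::ab_group_add \<Rightarrow> real"
  assumes "f summable_on UNIV" "\<And>x. 0 \<le> f x" "g summable_on UNIV" "\<And>x. 0 \<le> g x"
  shows "(\<lambda>(x,y). f y * g (x - y)) summable_on UNIV"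
proof -
  have "(\<lambda>(y,z). f y * g z) summable_on UNIV"
    using summable_on_times_nonneg[of f UNIV g UNIV] assms by simp
  then show ?thesis
    using summable_on_reindex_bij_betw[OF bij_diff_swap, of "\<lambda>(y,z). f y * g z"]
    by (simp add: case_prod_unfold)
qed

text \<open>Tonelli and translation invariance: the mass of a convolution is the product of the
  masses. This is behind both the submultiplicative norm of sequences and the l2 bound of
  operators.\<close>

lemma infsum_conv_nonneg:
  fixes f g :: "'g::ab_group_add \<Rightarrow> real"
  assumes "f summable_on UNIV" "\<And>x. 0 \<le> f x" "g summable_on UNIV" "\<And>x. 0 \<le> g x"
  shows "(\<lambda>x. \<Sum>\<^sub>\<infinity>y. f y * g (x - y)) summable_on UNIV"
    and "(\<Sum>\<^sub>\<infinity>x. \<Sum>\<^sub>\<infinity>y. f y * g (x - y)) = infsum f UNIV * infsum g UNIV"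
    and "(\<lambda>y. f y * g (x - y)) summable_on UNIV"
proof -
  have s: "(\<lambda>(x,y). f y * g (x - y)) summable_on (UNIV \<times> UNIV)"
    using summable_on_conv_nonneg[OF assms] by simp
  have s': "(\<lambda>(y,x). f y * g (x - y)) summable_on (UNIV \<times> UNIV)"
    using s summable_on_swap[of "\<lambda>(x,y). f y * g (x - y)" UNIV UNIV] by (simp add: case_prod_unfold)
  show "(\<lambda>x. \<Sum>\<^sub>\<infinity>y. f y * g (x - y)) summable_on UNIV"
    using summable_on_Sigma_banach[OF s] by simp
  show "(\<lambda>y. f y * g (x - y)) summable_on UNIV" for x
    using summable_on_SigmaD1[OF s, of x] by simp
  have "(\<Sum>\<^sub>\<infinity>x. g (x - y)) = infsum g UNIV" for y
    by (rule infsum_reindex_bij_betw) (rule bij_betwI[where g="\<lambda>z. z + y"]; simp)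
  then have "(\<Sum>\<^sub>\<infinity>y. \<Sum>\<^sub>\<infinity>x. f y * g (x - y)) = infsum f UNIV * infsum g UNIV"
    by (simp add: infsum_cmult_right' infsum_cmult_left')
  then show "(\<Sum>\<^sub>\<infinity>x. \<Sum>\<^sub>\<infinity>y. f y * g (x - y)) = infsum f UNIV * infsum g UNIV"
    using infsum_swap_banach[OF s] by simp
qed

definition conv :: "('g::ab_group_add \<Rightarrow> complex) \<Rightarrow> ('g \<Rightarrow> complex) \<Rightarrow> 'g \<Rightarrow> complex" where
  "conv a b x = (\<Sum>\<^sub>\<infinity>y. a y * b (x - y))"

lemma conv_summable:
  fixes a b :: "'g::ab_group_add \<Rightarrow> complex"
  assumes "(\<lambda>x. norm (a x)) summable_on UNIV" "(\<lambda>x. norm (b x)) summable_on UNIV"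
  shows "(\<lambda>y. norm (a y * b (x - y))) summable_on UNIV" "(\<lambda>y. a y * b (x - y)) summable_on UNIV"
proof -
  show "(\<lambda>y. norm (a y * b (x - y))) summable_on UNIV"
    using infsum_conv_nonneg(3)[OF assms(1) _ assms(2)] by (simp add: norm_mult)
  then show "(\<lambda>y. a y * b (x - y)) summable_on UNIV" by (rule abs_summable_summable)
qed

lemma conv_commute:
  fixes a b :: "'g::ab_group_add \<Rightarrow> complex"
  shows "conv a b = conv b a"
proof
  fix x :: 'g
  have "bij_betw (\<lambda>y. x - y) UNIV UNIV" by (rule bij_betwI[where g="\<lambda>y. x - y"]) auto
  from infsum_reindex_bij_betw[OF this, of "\<lambda>y. a y * b (x - y)"]
  show "conv a b x = conv b a x" by (simp add: conv_def mult.commute)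
qed

lemma conv_add:
  assumes "(\<lambda>x. norm (a x)) summable_on UNIV" "(\<lambda>x. norm (a' x)) summable_on UNIV" "(\<lambda>x. norm (b x)) summable_on UNIV"
  shows "conv (\<lambda>x. a x + a' x) b x = conv a b x + conv a' b x"
  unfolding conv_def distrib_right
  by (rule infsum_add) (use conv_summable assms in blast)+

lemma conv_assoc:
  fixes a b c :: "'g::ab_group_add \<Rightarrow> complex"
  assumes "(\<lambda>x. norm (a x)) summable_on UNIV" "(\<lambda>x. norm (b x)) summable_on UNIV" "(\<lambda>x. norm (c x)) summable_on UNIV"
  shows "conv (conv a b) c x = conv a (conv b c) x"
proof -
  \<comment> \<open>Replacing \<open>c\<close> by a uniform bound leaves the convolution family of
    \<open>a\<close> and \<open>b\<close>, which already dominates the double family and licenses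
    Fubini.\<close>
  define M where "M = (\<Sum>\<^sub>\<infinity>y. norm (c y))"
  have M: "norm (c y) \<le> M" for y unfolding M_def by (rule norm_le_infsum_norm[OF assms(3)])
  have "(\<lambda>(y,z). norm (a z) * norm (b (y - z)) * M) summable_on UNIV"
    using summable_on_cmult_left[OF summable_on_conv_nonneg[OF assms(1) _ assms(2)], of M] by (simp add: case_prod_unfold)
  then have "(\<lambda>(y,z). norm (a z * b (y - z) * c (x - y))) summable_on UNIV"
    by (rule summable_on_le) (auto simp: norm_mult intro!: mult_left_mono M)
  then have s: "(\<lambda>(y,z). a z * b (y - z) * c (x - y)) summable_on (UNIV \<times> UNIV)"
    unfolding UNIV_Times_UNIV case_prod_unfold by (rule abs_summable_summable)
  have "conv (conv a b) c x = (\<Sum>\<^sub>\<infinity>y. \<Sum>\<^sub>\<infinity>z. a z * b (y - z) * c (x - y))"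
    unfolding conv_def by (simp add: infsum_cmult_left')
  also have "\<dots> = (\<Sum>\<^sub>\<infinity>z. \<Sum>\<^sub>\<infinity>y. a z * b (y - z) * c (x - y))"
    by (rule infsum_swap_banach[OF s])
  also have "\<dots> = (\<Sum>\<^sub>\<infinity>z. a z * (\<Sum>\<^sub>\<infinity>y. b (y - z) * c (x - y)))"
    by (simp add: infsum_cmult_right' mult.assoc)
  also have "\<dots> = (\<Sum>\<^sub>\<infinity>z. a z * (\<Sum>\<^sub>\<infinity>y. b y * c (x - z - y)))"
  proof (rule infsum_cong)
    fix z :: 'g
    have "bij_betw (\<lambda>y. y - z) UNIV UNIV" by (rule bij_betwI[where g="\<lambda>y. y + z"]) auto
    from infsum_reindex_bij_betw[OF this, of "\<lambda>y. b y * c (x - z - y)"]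
    show "a z * (\<Sum>\<^sub>\<infinity>y. b (y - z) * c (x - y)) = a z * (\<Sum>\<^sub>\<infinity>y. b y * c (x - z - y))"
      by simp
  qed
  finally show ?thesis by (simp add: conv_def)
qed

section \<open>The ring of exponentially decaying sequences\<close>

definition sz :: "site \<Rightarrow> nat" where
  "sz x = nat (\<bar>fst x\<bar> + \<bar>snd x\<bar>)"

lemma sz_add: "sz (x + y) \<le> sz x + sz y"
  unfolding sz_def by (simp add: nat_le_iff)

lemma sz_minus [simp]: "sz (- x) = sz x"
  unfolding sz_def by simp

lemma sz_zero [simp]: "sz 0 = 0"
  unfolding sz_def by simp

lemma l1dist_eq_sz: "l1dist x y = sz (x - y)"
  unfolding sz_def l1dist_def by simp

section \<open>Weighted l1 norms\<close>

definition wsum :: "real \<Rightarrow> (site \<Rightarrow> complex) \<Rightarrow> bool" where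
  "wsum \<rho> a \<longleftrightarrow> (\<lambda>x. norm (a x) * \<rho> ^ sz x) summable_on UNIV"

definition wnorm :: "real \<Rightarrow> (site \<Rightarrow> complex) \<Rightarrow> real" where
  "wnorm \<rho> a = (\<Sum>\<^sub>\<infinity>x. norm (a x) * \<rho> ^ sz x)"

lemma wsum_mono:
  assumes "wsum \<rho> a" "0 \<le> \<rho>'" "\<rho>' \<le> \<rho>"
  shows "wsum \<rho>' a"
  unfolding wsum_def
  by (rule summable_on_le[OF assms(1)[unfolded wsum_def]])
    (use assms in \<open>auto intro!: mult_left_mono power_mono\<close>)

lemma wsum_summable:
  assumes "wsum \<rho> a" "1 \<le> \<rho>"
  shows "(\<lambda>x. norm (a x)) summable_on UNIV"
  using wsum_mono[OF assms(1), of 1] assms(2) unfolding wsum_def by simp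

lemma wnorm_bound:
  assumes "wsum \<rho> a" "0 \<le> \<rho>"
  shows "norm (a x) * \<rho> ^ sz x \<le> wnorm \<rho> a"
  using norm_le_infsum_norm[of "\<lambda>x. norm (a x) * \<rho> ^ sz x" x] assms
  unfolding wsum_def wnorm_def by simp

lemma wsum_add:
  assumes "wsum \<rho> a" "wsum \<rho> b" "0 \<le> \<rho>"
  shows "wsum \<rho> (\<lambda>x. a x + b x)"
  unfolding wsum_def
proof (rule summable_on_le)
  show "(\<lambda>x. norm (a x) * \<rho> ^ sz x + norm (b x) * \<rho> ^ sz x) summable_on UNIV"
    using assms unfolding wsum_def by (intro summable_on_add)
  show "norm (a x + b x) * \<rho> ^ sz x \<le> norm (a x) * \<rho> ^ sz x + norm (b x) * \<rho> ^ sz x" for x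
    unfolding distrib_right[symmetric] using assms(3) by (intro mult_right_mono norm_triangle_ineq) auto
qed (use assms in auto)

text \<open>Subadditivity of \<open>sz\<close> makes the weight submultiplicative for
  \<open>1 \<le> \<rho>\<close>, so weighted families convolve as in l1. The power series below rest
  on these Banach algebra estimates.\<close>

lemma wsum_conv:
  assumes a: "wsum \<rho> a" and b: "wsum \<rho> b" and \<rho>: "1 \<le> \<rho>"
  shows "wsum \<rho> (conv a b)" "wnorm \<rho> (conv a b) \<le> wnorm \<rho> a * wnorm \<rho> b"
proof -
  let ?f = "\<lambda>x. norm (a x) * \<rho> ^ sz x" and ?g = "\<lambda>x. norm (b x) * \<rho> ^ sz x"
  note fg = infsum_conv_nonneg[of ?f ?g, OF a[unfolded wsum_def] _ b[unfolded wsum_def]]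
  have le: "norm (conv a b x) * \<rho> ^ sz x \<le> (\<Sum>\<^sub>\<infinity>y. ?f y * ?g (x - y))" for x
  proof -
    have s: "(\<lambda>y. norm (a y * b (x - y))) summable_on UNIV"
      using conv_summable(1) wsum_summable a b \<rho> by blast
    have "norm (conv a b x) * \<rho> ^ sz x \<le> (\<Sum>\<^sub>\<infinity>y. norm (a y * b (x - y))) * \<rho> ^ sz x"
      unfolding conv_def by (rule mult_right_mono[OF norm_infsum_bound[OF s]]) (use \<rho> in auto)
    also have "\<dots> = (\<Sum>\<^sub>\<infinity>y. norm (a y * b (x - y)) * \<rho> ^ sz x)"
      by (simp add: infsum_cmult_left')
    also have "\<dots> \<le> (\<Sum>\<^sub>\<infinity>y. ?f y * ?g (x - y))"
    proof (rule infsum_mono)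
      show "(\<lambda>y. norm (a y * b (x - y)) * \<rho> ^ sz x) summable_on UNIV"
        by (rule summable_on_cmult_left[OF s])
      show "(\<lambda>y. ?f y * ?g (x - y)) summable_on UNIV" using fg(3)[of x] \<rho> by simp
      fix y
      have "sz x \<le> sz y + sz (x - y)" using sz_add[of y "x - y"] by simp
      then have "\<rho> ^ sz x \<le> \<rho> ^ sz y * \<rho> ^ sz (x - y)"
        unfolding power_add[symmetric] by (rule power_increasing[OF _ \<rho>])
      then have "(norm (a y) * norm (b (x - y))) * \<rho> ^ sz x
          \<le> (norm (a y) * norm (b (x - y))) * (\<rho> ^ sz y * \<rho> ^ sz (x - y))"
        by (rule mult_left_mono) simp
      then show "norm (a y * b (x - y)) * \<rho> ^ sz x \<le> ?f y * ?g (x - y)"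
        by (simp add: norm_mult mult_ac)
    qed
    finally show ?thesis .
  qed
  show s: "wsum \<rho> (conv a b)" unfolding wsum_def
    by (rule summable_on_le[OF fg(1)]) (use \<rho> le in auto)
  have "wnorm \<rho> (conv a b) \<le> (\<Sum>\<^sub>\<infinity>x. \<Sum>\<^sub>\<infinity>y. ?f y * ?g (x - y))"
    unfolding wnorm_def by (rule infsum_mono[OF s[unfolded wsum_def] fg(1) le]) (use \<rho> in auto)
  also have "\<dots> = wnorm \<rho> a * wnorm \<rho> b" unfolding wnorm_def by (rule fg(2)) (use \<rho> in auto)
  finally show "wnorm \<rho> (conv a b) \<le> wnorm \<rho> a * wnorm \<rho> b" .
qed

text \<open>Fourier coefficients of functions analytic near the real torus. The weight is quantified
  existentially because multiplication by a coordinate costs part of the decay, so no fixed weight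
  gives a ring stable under the derivations.\<close>

definition exp_decaying :: "(site \<Rightarrow> complex) \<Rightarrow> bool" where
  "exp_decaying a \<longleftrightarrow> (\<exists>\<rho>>1. wsum \<rho> a)"

lemma exp_decayingI: "1 < \<rho> \<Longrightarrow> wsum \<rho> a \<Longrightarrow> exp_decaying a"
  unfolding exp_decaying_def by blast

lemma exp_decaying_common:
  assumes "exp_decaying a" "exp_decaying b"
  obtains \<rho> where "1 < \<rho>" "wsum \<rho> a" "wsum \<rho> b"
proof -
  obtain \<rho>1 \<rho>2 where "1 < \<rho>1" "wsum \<rho>1 a" "1 < \<rho>2" "wsum \<rho>2 b"
    using assms unfolding exp_decaying_def by blast
  then show ?thesis
    using that[of "min \<rho>1 \<rho>2"] wsum_mono[of \<rho>1 a "min \<rho>1 \<rho>2"] wsum_mono[of \<rho>2 b "min \<rho>1 \<rho>2"] by auto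
qed

lemma exp_decaying_finite_support:
  assumes "finite {x. a x \<noteq> 0}"
  shows "exp_decaying a"
proof (rule exp_decayingI[of 2])
  show "wsum 2 a" unfolding wsum_def
    by (rule finite_nonzero_values_imp_summable_on) (use assms in auto)
qed simp

text \<open>A type of its own lets symbols be multiplied, and 2 by 2 matrices over them composed,
  with the generic rules for commutative rings.\<close>

typedef expseq = "{a. exp_decaying a}"
  by (rule exI[of _ "\<lambda>x. 0"]) (simp add: exp_decaying_finite_support)

setup_lifting type_definition_expseq

lift_definition cf :: "expseq \<Rightarrow> site \<Rightarrow> complex" is "\<lambda>a. a" .

lemma expseq_eqI: "(\<And>x. cf a x = cf b x) \<Longrightarrow> a = b"
  by transfer auto

lemma exp_decaying_cf: "exp_decaying (cf a)"
  by transfer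

lemma cf_summable: "(\<lambda>x. norm (cf a x)) summable_on UNIV"
  using exp_decaying_cf[of a] wsum_summable less_imp_le unfolding exp_decaying_def by blast

lemma exp_decaying_add: "exp_decaying a \<Longrightarrow> exp_decaying b \<Longrightarrow> exp_decaying (\<lambda>x. a x + b x)"
  by (elim exp_decaying_common[of a b]) (auto intro!: exp_decayingI wsum_add)

lemma exp_decaying_uminus: "exp_decaying a \<Longrightarrow> exp_decaying (\<lambda>x. - a x)"
  unfolding exp_decaying_def wsum_def by simp

lemma exp_decaying_conv: "exp_decaying a \<Longrightarrow> exp_decaying b \<Longrightarrow> exp_decaying (conv a b)"
  by (elim exp_decaying_common[of a b]) (auto intro!: exp_decayingI wsum_conv)

section \<open>The convolution ring\<close>

instantiation expseq :: comm_ring_1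
begin

lift_definition zero_expseq :: expseq is "\<lambda>x. 0"
  by (rule exp_decaying_finite_support) simp

lift_definition one_expseq :: expseq is "\<lambda>x. if x = 0 then 1 else 0"
  by (rule exp_decaying_finite_support) simp

lift_definition plus_expseq :: "expseq \<Rightarrow> expseq \<Rightarrow> expseq" is "\<lambda>a b x. a x + b x"
  by (rule exp_decaying_add)

lift_definition uminus_expseq :: "expseq \<Rightarrow> expseq" is "\<lambda>a x. - a x"
  by (rule exp_decaying_uminus)

lift_definition minus_expseq :: "expseq \<Rightarrow> expseq \<Rightarrow> expseq" is "\<lambda>a b x. a x - b x"
  using exp_decaying_add exp_decaying_uminus by fastforce

lift_definition times_expseq :: "expseq \<Rightarrow> expseq \<Rightarrow> expseq" is "conv"
  by (rule exp_decaying_conv)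

instance
proof
  fix a b c :: expseq
  have *: "(\<lambda>x. norm (cf a x)) summable_on UNIV" for a by (rule cf_summable)
  have cf_times: "cf (a * b) = conv (cf a) (cf b)" for a b by transfer simp
  have cf_plus: "cf (a + b) = (\<lambda>x. cf a x + cf b x)" for a b by transfer simp
  show "a * b * c = a * (b * c)"
    by (rule expseq_eqI) (simp add: cf_times conv_assoc *)
  show "a * b = b * a"
    by (rule expseq_eqI) (simp add: cf_times conv_commute)
  show "(a + b) * c = a * c + b * c"
    by (rule expseq_eqI) (simp add: cf_times cf_plus conv_add *)
  show "1 * a = a"
  proof (rule expseq_eqI)
    fix x
    have "(\<Sum>\<^sub>\<infinity>y. cf 1 y * cf a (x - y)) = (\<Sum>\<^sub>\<infinity>y\<in>{0}. cf 1 y * cf a (x - y))"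
      by (rule infsum_cong_neutral) (auto simp: one_expseq.rep_eq cf.rep_eq)
    then show "cf (1 * a) x = cf a x" by (simp add: cf_times conv_def) (simp add: one_expseq.rep_eq cf.rep_eq)
  qed
  show "(0::expseq) \<noteq> 1" by transfer (metis zero_neq_one)
  show "a + b + c = a + (b + c)" "a + b = b + a" "0 + a = a" "- a + a = 0" "a - b = a + - b"
    by (transfer; auto)+
qed

end

lemma cf_zero [simp]: "cf 0 x = 0" by transfer simp
lemma cf_one: "cf 1 x = (if x = 0 then 1 else 0)" by transfer simp
lemma cf_plus [simp]: "cf (a + b) x = cf a x + cf b x" by transfer simp
lemma cf_uminus [simp]: "cf (- a) x = - cf a x" by transfer simp
lemma cf_minus [simp]: "cf (a - b) x = cf a x - cf b x" by transfer simp
lemma cf_times: "cf (a * b) x = (\<Sum>\<^sub>\<infinity>y. cf a y * cf b (x - y))" by transfer (simp add: conv_def)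
lemma cf_times_conv: "cf (a * b) = conv (cf a) (cf b)" by transfer simp

lemma cf_wsum:
  obtains \<rho> where "1 < \<rho>" "wsum \<rho> (cf a)"
  using exp_decaying_cf[of a] unfolding exp_decaying_def by blast

lift_definition single :: "complex \<Rightarrow> site \<Rightarrow> expseq" is "\<lambda>c z x. if x = z then c else 0"
  by (rule exp_decaying_finite_support) auto

lemma cf_single: "cf (single c z) x = (if x = z then c else 0)"
  by transfer simp

lemma single_mult: "single c z * single d w = single (c * d) (z + w)"
proof (rule expseq_eqI)
  fix x
  have "cf (single c z * single d w) x = (\<Sum>\<^sub>\<infinity>y\<in>{z}. cf (single c z) y * cf (single d w) (x - y))"
    unfolding cf_times by (rule infsum_cong_neutral) (auto simp: cf_single)
  then show "cf (single c z * single d w) x = cf (single (c * d) (z + w)) x"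
    by (simp add: cf_single algebra_simps)
qed

lemma single_one: "single 1 0 = 1" by (rule expseq_eqI) (simp add: cf_single cf_one)
lemma single_add: "single c z + single d z = single (c + d) z" by (rule expseq_eqI) (simp add: cf_single)

text \<open>Coefficients of the complex conjugate function: \<open>star a = a\<close> says that the
  symbol is real-valued on the torus.\<close>

lift_definition star :: "expseq \<Rightarrow> expseq" is "\<lambda>a x. cnj (a (- x))"
proof -
  fix a assume "exp_decaying a"
  then obtain \<rho> where \<rho>: "1 < \<rho>" "wsum \<rho> a" unfolding exp_decaying_def by blast
  have "bij (uminus :: site \<Rightarrow> site)" by (rule bij_betwI[where g=uminus]) auto
  from summable_on_reindex_bij_betw[OF this, of "\<lambda>x. norm (a x) * \<rho> ^ sz x"] \<rho>(2)
  have "wsum \<rho> (\<lambda>x. cnj (a (- x)))" unfolding wsum_def by simp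
  then show "exp_decaying (\<lambda>x. cnj (a (- x)))" using \<rho>(1) exp_decayingI by blast
qed

lemma cf_star: "cf (star a) x = cnj (cf a (- x))" by transfer simp

lemma star_plus: "star (a + b) = star a + star b"
  by (rule expseq_eqI) (simp add: cf_star)
lemma star_minus: "star (a - b) = star a - star b"
  by (rule expseq_eqI) (simp add: cf_star)
lemma star_one: "star 1 = 1"
  by (rule expseq_eqI) (simp add: cf_star cf_one)
lemma star_single: "star (single c z) = single (cnj c) (- z)"
  by (rule expseq_eqI) (auto simp add: cf_star cf_single)

lemma star_times: "star (a * b) = star a * star b"
proof (rule expseq_eqI)
  fix x
  have "bij (uminus :: site \<Rightarrow> site)" by (rule bij_betwI[where g=uminus]) auto
  from infsum_reindex_bij_betw[OF this, of "\<lambda>y. cnj (cf a y * cf b (- x - y))"]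
  show "cf (star (a * b)) x = cf (star a * star b) x"
    by (simp add: cf_star cf_times flip: infsum_cnj)
qed

lemma star_power: "star (a ^ n) = star a ^ n"
  by (induction n) (simp_all add: star_one star_times)

text \<open>Parseval for a real symbol: self-adjointness turns \<open>cf a (- x)\<close> into the
  conjugate of \<open>cf a x\<close>, so the convolution at 0 is a sum of squared moduli.\<close>

lemma cf_zero_self_mult:
  assumes "star a = a"
  shows "cf (a * a) 0 = of_real (\<Sum>\<^sub>\<infinity>x. (norm (cf a x))\<^sup>2)" and "(\<lambda>x. (norm (cf a x))\<^sup>2) summable_on UNIV"
proof -
  have eq: "cf a x * cf a (0 - x) = of_real ((norm (cf a x))\<^sup>2)" for x
    using cf_star[of a "-x"] assms complex_norm_square[of "cf a x"] by simp
  have "(\<lambda>x. cf a x * cf a (0 - x)) summable_on UNIV"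
    by (rule conv_summable(2)[OF cf_summable cf_summable])
  then show s: "(\<lambda>x. (norm (cf a x))\<^sup>2) summable_on UNIV"
    unfolding eq by (drule_tac summable_on_Re) simp
  show "cf (a * a) 0 = of_real (\<Sum>\<^sub>\<infinity>x. (norm (cf a x))\<^sup>2)"
    unfolding cf_times eq using has_sum_of_real[OF has_sum_infsum[OF s], where 'a=complex] by (rule infsumI)
qed

lemma self_mult_cf_zero_eq_0:
  assumes "star a = a" "cf (a * a) 0 = 0"
  shows "a = 0"
proof (rule expseq_eqI)
  fix x
  have "(norm (cf a x))\<^sup>2 \<le> (\<Sum>\<^sub>\<infinity>x. (norm (cf a x))\<^sup>2)"
    using finite_sum_le_infsum[OF cf_zero_self_mult(2)[OF assms(1)], of "{x}"] by simp
  then have "(norm (cf a x))\<^sup>2 \<le> 0" using cf_zero_self_mult(1)[OF assms(1)] assms(2) by simp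
  then show "cf a x = cf 0 x" by simp
qed

text \<open>Half of the exponential rate pays for a linear factor: with \<open>1 + \<delta>\<close>
  the square root of \<open>\<rho>\<close>, Bernoulli bounds \<open>n\<close> by a multiple of
  \<open>(1 + \<delta>) ^ n\<close>.\<close>

lemma exp_decaying_weighted:
  assumes "exp_decaying a" "\<And>x. norm (p x) \<le> real (sz x)"
  shows "exp_decaying (\<lambda>x. p x * a x)"
proof -
  obtain \<rho> where \<rho>: "1 < \<rho>" "wsum \<rho> a" using assms unfolding exp_decaying_def by blast
  define \<delta> where "\<delta> = sqrt \<rho> - 1"
  have \<delta>: "\<delta> > 0" and sq: "(1 + \<delta>) * (1 + \<delta>) = \<rho>" unfolding \<delta>_def using \<rho>(1) by auto
  have n: "real n * (1 + \<delta>) ^ n \<le> (1 / \<delta>) * \<rho> ^ n" for n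
  proof -
    have "1 + real n * \<delta> \<le> (1 + \<delta>) ^ n" using Bernoulli_inequality[of \<delta> n] \<delta> by (simp add: mult.commute)
    then have "real n \<le> (1 / \<delta>) * (1 + \<delta>) ^ n" using \<delta> by (simp add: field_simps)
    then have "real n * (1 + \<delta>) ^ n \<le> (1 / \<delta>) * (1 + \<delta>) ^ n * (1 + \<delta>) ^ n"
      by (rule mult_right_mono) (use \<delta> in auto)
    then show ?thesis by (simp add: sq mult.assoc flip: power_mult_distrib)
  qed
  have "wsum (1 + \<delta>) (\<lambda>x. p x * a x)" unfolding wsum_def
  proof (rule summable_on_le)
    show "(\<lambda>x. (1 / \<delta>) * (norm (a x) * \<rho> ^ sz x)) summable_on UNIV"
      using \<rho>(2) unfolding wsum_def by (rule summable_on_cmult_right)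
    fix x
    have "norm (p x * a x) * (1 + \<delta>) ^ sz x \<le> norm (a x) * (real (sz x) * (1 + \<delta>) ^ sz x)"
      using mult_right_mono[OF assms(2)[of x], of "norm (a x) * (1 + \<delta>) ^ sz x"] \<delta>
      by (simp add: norm_mult mult_ac)
    also have "\<dots> \<le> norm (a x) * ((1 / \<delta>) * \<rho> ^ sz x)" by (intro mult_left_mono n) auto
    finally show "norm (p x * a x) * (1 + \<delta>) ^ sz x \<le> (1 / \<delta>) * (norm (a x) * \<rho> ^ sz x)"
      by (simp add: mult_ac)
  qed (use \<delta> in auto)
  then show ?thesis using \<delta> exp_decayingI[of "1 + \<delta>"] by auto
qed

text \<open>On symbols, \<open>D1\<close> and \<open>D2\<close> are \<open>- \<i>\<close> times the partial derivatives in the quasimomenta.\<close>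

lift_definition D1 :: "expseq \<Rightarrow> expseq" is "\<lambda>a x. of_int (fst x) * a x"
  by (rule exp_decaying_weighted) (auto simp: sz_def simp flip: of_int_abs)

lift_definition D2 :: "expseq \<Rightarrow> expseq" is "\<lambda>a x. of_int (snd x) * a x"
  by (rule exp_decaying_weighted) (auto simp: sz_def simp flip: of_int_abs)

lemma cf_D1: "cf (D1 a) x = of_int (fst x) * cf a x" by transfer simp
lemma cf_D2: "cf (D2 a) x = of_int (snd x) * cf a x" by transfer simp

lemma D_plus: "D1 (a + b) = D1 a + D1 b" "D2 (a + b) = D2 a + D2 b"
  by (rule expseq_eqI, simp add: cf_D1 cf_D2 algebra_simps)+
lemma D_minus: "D1 (a - b) = D1 a - D1 b" "D2 (a - b) = D2 a - D2 b"
  by (rule expseq_eqI, simp add: cf_D1 cf_D2 algebra_simps)+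
lemma D_single: "D1 (single c z) = single (of_int (fst z) * c) z" "D2 (single c z) = single (of_int (snd z) * c) z"
  by (rule expseq_eqI, simp add: cf_D1 cf_D2 cf_single)+
lemma D_one: "D1 1 = 0" "D2 1 = 0"
  by (rule expseq_eqI, simp add: cf_D1 cf_D2 cf_one)+
text \<open>Leibniz rule: under the convolution sum the coordinate of \<open>x\<close> splits into
  those of \<open>y\<close> and \<open>x - y\<close>.\<close>

lemma D_times: "D1 (a * b) = D1 a * b + a * D1 b" "D2 (a * b) = D2 a * b + a * D2 b"
proof -
  have sum: "(\<lambda>y. cf a y * cf b (x - y)) summable_on UNIV" for a b x
    by (rule conv_summable(2)[OF cf_summable cf_summable])
  show "D1 (a * b) = D1 a * b + a * D1 b"
  proof (rule expseq_eqI)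
    fix x
    have "cf (D1 a * b + a * D1 b) x = (\<Sum>\<^sub>\<infinity>y. cf (D1 a) y * cf b (x - y) + cf a y * cf (D1 b) (x - y))"
      by (simp add: cf_times infsum_add[OF sum sum])
    also have "\<dots> = (\<Sum>\<^sub>\<infinity>y. of_int (fst x) * (cf a y * cf b (x - y)))"
      by (rule infsum_cong) (simp add: cf_D1 algebra_simps)
    finally show "cf (D1 (a * b)) x = cf (D1 a * b + a * D1 b) x"
      by (simp add: cf_D1 cf_times infsum_cmult_right')
  qed
  show "D2 (a * b) = D2 a * b + a * D2 b"
  proof (rule expseq_eqI)
    fix x
    have "cf (D2 a * b + a * D2 b) x = (\<Sum>\<^sub>\<infinity>y. cf (D2 a) y * cf b (x - y) + cf a y * cf (D2 b) (x - y))"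
      by (simp add: cf_times infsum_add[OF sum sum])
    also have "\<dots> = (\<Sum>\<^sub>\<infinity>y. of_int (snd x) * (cf a y * cf b (x - y)))"
      by (rule infsum_cong) (simp add: cf_D2 algebra_simps)
    finally show "cf (D2 (a * b)) x = cf (D2 a * b + a * D2 b) x"
      by (simp add: cf_D2 cf_times infsum_cmult_right')
  qed
qed

section \<open>Binomial series in the sequence ring\<close>

lemma cf_single_0_times: "cf (single c 0 * a) x = c * cf a x"
proof -
  have "cf (single c 0 * a) x = (\<Sum>\<^sub>\<infinity>y\<in>{0}. cf (single c 0) y * cf a (x - y))"
    unfolding cf_times by (rule infsum_cong_neutral) (auto simp: cf_single)
  then show ?thesis by (simp add: cf_single)
qed

lemma wsum_single [simp]: "wsum \<rho> (cf (single c z))"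
  unfolding wsum_def by (rule finite_nonzero_values_imp_summable_on) (simp add: cf_single)

lemma wnorm_single: "wnorm \<rho> (cf (single c z)) = norm c * \<rho> ^ sz z"
proof -
  have "wnorm \<rho> (cf (single c z)) = (\<Sum>\<^sub>\<infinity>x\<in>{z}. norm (cf (single c z) x) * \<rho> ^ sz x)"
    unfolding wnorm_def by (rule infsum_cong_neutral) (auto simp: cf_single)
  then show ?thesis by (simp add: cf_single)
qed

lemma wsum_cf_add:
  assumes "wsum \<rho> (cf a)" "wsum \<rho> (cf b)" "0 \<le> \<rho>"
  shows "wsum \<rho> (cf (a + b))" "wnorm \<rho> (cf (a + b)) \<le> wnorm \<rho> (cf a) + wnorm \<rho> (cf b)"
proof -
  show s: "wsum \<rho> (cf (a + b))" using wsum_add[OF assms] by (simp add: wsum_def)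
  have "wnorm \<rho> (cf (a + b)) \<le> (\<Sum>\<^sub>\<infinity>x. norm (cf a x) * \<rho> ^ sz x + norm (cf b x) * \<rho> ^ sz x)"
    unfolding wnorm_def
  proof (rule infsum_mono)
    show "(\<lambda>x. norm (cf (a + b) x) * \<rho> ^ sz x) summable_on UNIV" using s unfolding wsum_def .
    show "(\<lambda>x. norm (cf a x) * \<rho> ^ sz x + norm (cf b x) * \<rho> ^ sz x) summable_on UNIV"
      using assms unfolding wsum_def by (intro summable_on_add)
    show "norm (cf (a + b) x) * \<rho> ^ sz x \<le> norm (cf a x) * \<rho> ^ sz x + norm (cf b x) * \<rho> ^ sz x" for x
      unfolding distrib_right[symmetric] using assms(3) by (intro mult_right_mono) (auto intro: norm_triangle_ineq)
  qed
  also have "\<dots> = wnorm \<rho> (cf a) + wnorm \<rho> (cf b)"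
    unfolding wnorm_def using assms unfolding wsum_def by (intro infsum_add)
  finally show "wnorm \<rho> (cf (a + b)) \<le> wnorm \<rho> (cf a) + wnorm \<rho> (cf b)" .
qed

lemma wsum_cf_times:
  assumes "wsum \<rho> (cf a)" "wsum \<rho> (cf b)" "1 \<le> \<rho>"
  shows "wsum \<rho> (cf (a * b))" "wnorm \<rho> (cf (a * b)) \<le> wnorm \<rho> (cf a) * wnorm \<rho> (cf b)"
  using wsum_conv[OF assms] by (simp_all add: cf_times_conv)

lemma wnorm_nonneg: "0 \<le> \<rho> \<Longrightarrow> 0 \<le> wnorm \<rho> a"
  unfolding wnorm_def by (rule infsum_nonneg) simp

lemma wsum_cf_power:
  assumes "wsum \<rho> (cf q)" "1 \<le> \<rho>"
  shows "wsum \<rho> (cf (q ^ n)) \<and> wnorm \<rho> (cf (q ^ n)) \<le> wnorm \<rho> (cf q) ^ n"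
proof (induction n)
  case 0
  show ?case using wsum_single[of \<rho> 1 0] wnorm_single[of \<rho> 1 0] by (simp add: single_one)
next
  case (Suc n)
  have "wnorm \<rho> (cf q) * wnorm \<rho> (cf (q ^ n)) \<le> wnorm \<rho> (cf q) * wnorm \<rho> (cf q) ^ n"
    using Suc assms wnorm_nonneg[of \<rho>] by (intro mult_left_mono) auto
  then show ?case
    using wsum_cf_times[OF assms(1) conjunct1[OF Suc] assms(2)] by simp
qed

text \<open>The series is summed coefficient by coefficient, so \<open>expseq\<close> needs no
  topology. The value is meaningful when the resulting function decays exponentially, which
  \<open>admissible\<close> below guarantees.\<close>

definition pser :: "expseq \<Rightarrow> (nat \<Rightarrow> real) \<Rightarrow> expseq" where
  "pser q c = Abs_expseq (\<lambda>x. \<Sum>\<^sub>\<infinity>n. of_real (c n) * cf (q ^ n) x)"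

context
  fixes q :: expseq and \<rho> r :: real
  assumes q: "1 < \<rho>" "wsum \<rho> (cf q)" and r: "r = wnorm \<rho> (cf q)"
begin

definition admissible :: "(nat \<Rightarrow> real) \<Rightarrow> bool" where
  "admissible c \<longleftrightarrow> (\<lambda>n. \<bar>c n\<bar> * r ^ n) summable_on UNIV"

lemma cf_power_le: "norm (cf (q ^ n) x) * \<rho> ^ sz x \<le> r ^ n" "norm (cf (q ^ n) x) \<le> r ^ n"
proof -
  have \<rho>: "0 \<le> \<rho>" "1 \<le> \<rho>" using q by auto
  note w = wsum_cf_power[OF q(2) \<rho>(2), of n, folded r]
  show *: "norm (cf (q ^ n) x) * \<rho> ^ sz x \<le> r ^ n"
    using wnorm_bound[OF conjunct1[OF w] \<rho>(1), of x] conjunct2[OF w] by linarith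
  have "norm (cf (q ^ n) x) * 1 \<le> norm (cf (q ^ n) x) * \<rho> ^ sz x"
    using \<rho> by (intro mult_left_mono one_le_power) auto
  then show "norm (cf (q ^ n) x) \<le> r ^ n" using * by simp
qed

lemma pser_summable_weighted:
  assumes "admissible c"
  shows "(\<lambda>(n,x). norm (of_real (c n) * cf (q ^ n) x) * \<rho> ^ sz x) summable_on UNIV"
proof -
  have w: "wsum \<rho> (cf (q ^ n))" "wnorm \<rho> (cf (q ^ n)) \<le> r ^ n" for n
    using wsum_cf_power[OF q(2), of n] q(1) r by auto
  have "(\<lambda>(n,x). norm (of_real (c n) * cf (q ^ n) x) * \<rho> ^ sz x) summable_on (UNIV \<times> UNIV)"
  proof (rule summable_on_SigmaI[where g="\<lambda>n. \<bar>c n\<bar> * wnorm \<rho> (cf (q ^ n))"])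
    show "((\<lambda>y. case (n, y) of (n, x) \<Rightarrow> norm (of_real (c n) * cf (q ^ n) x) * \<rho> ^ sz x)
        has_sum \<bar>c n\<bar> * wnorm \<rho> (cf (q ^ n))) UNIV" for n
      using has_sum_cmult_right[OF has_sum_infsum[OF w(1)[of n, unfolded wsum_def]], of "\<bar>c n\<bar>"]
      by (simp add: wnorm_def norm_mult mult_ac)
    show "(\<lambda>n. \<bar>c n\<bar> * wnorm \<rho> (cf (q ^ n))) summable_on UNIV"
      using assms unfolding admissible_def
      by (rule summable_on_le) (use q in \<open>auto intro!: mult_left_mono w(2) mult_nonneg_nonneg wnorm_nonneg\<close>)
  qed (use q in auto)
  then show ?thesis by simp
qed

lemma pser_summable_abs:
  assumes "admissible c"
  shows "(\<lambda>(n,x). norm (of_real (c n) * cf (q ^ n) x)) summable_on UNIV"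
proof (rule summable_on_le[OF pser_summable_weighted[OF assms]], goal_cases)
  case (2 z)
  obtain n x where z: "z = (n, x)" by (cases z)
  have "norm (of_real (c n) * cf (q ^ n) x) * 1 \<le> norm (of_real (c n) * cf (q ^ n) x) * \<rho> ^ sz x"
    using q by (intro mult_left_mono one_le_power) auto
  then show ?case by (simp add: z)
qed auto

lemma cf_pser:
  assumes "admissible c"
  shows "cf (pser q c) x = (\<Sum>\<^sub>\<infinity>n. of_real (c n) * cf (q ^ n) x)"
proof -
  let ?F = "\<lambda>(x::site) n. norm (of_real (c n) * cf (q ^ n) x) * \<rho> ^ sz x"
  have s: "(\<lambda>(x,n). ?F x n) summable_on (UNIV \<times> UNIV)"
    using pser_summable_weighted[OF assms] summable_on_swap[of "\<lambda>(n,x). ?F x n" UNIV UNIV]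
    by (simp add: case_prod_unfold)
  have "wsum \<rho> (\<lambda>x. \<Sum>\<^sub>\<infinity>n. of_real (c n) * cf (q ^ n) x)" unfolding wsum_def
  proof (rule summable_on_le)
    show "(\<lambda>x. \<Sum>\<^sub>\<infinity>n. ?F x n) summable_on UNIV" using summable_on_Sigma_banach[OF s] by simp
    fix x
    have "(\<lambda>n. norm (of_real (c n) * cf (q ^ n) x)) summable_on UNIV"
      using summable_on_cmult_left[OF summable_on_SigmaD1[OF s, of x], of "inverse (\<rho> ^ sz x)"] q
      by (simp add: mult.assoc)
    then show "norm (\<Sum>\<^sub>\<infinity>n. of_real (c n) * cf (q ^ n) x) * \<rho> ^ sz x \<le> (\<Sum>\<^sub>\<infinity>n. ?F x n)"
      using norm_infsum_bound q by (simp add: infsum_cmult_left' mult_right_mono)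
  qed (use q in auto)
  then have "exp_decaying (\<lambda>x. \<Sum>\<^sub>\<infinity>n. of_real (c n) * cf (q ^ n) x)"
    using q(1) exp_decayingI by blast
  then show ?thesis unfolding pser_def by (simp add: cf.rep_eq Abs_expseq_inverse)
qed

text \<open>Cauchy product. A coefficient of the left-hand side is a sum over a site and two
  exponents; absolute summability lets the site sum be done first, producing
  \<open>q ^ (m + n)\<close>, and the exponents be regrouped by their sum.\<close>

lemma pser_mult:
  assumes c: "admissible c" and d: "admissible d"
  shows "pser q c * pser q d = pser q (\<lambda>k. \<Sum>i\<le>k. c i * d (k - i))"
proof -
  have r0: "0 \<le> r" unfolding r by (rule wnorm_nonneg) (use q in auto)
  have "cf (pser q c * pser q d) x = (\<Sum>\<^sub>\<infinity>k. of_real (\<Sum>i\<le>k. c i * d (k - i)) * cf (q ^ k) x)" for x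
  proof -
    let ?A = "\<lambda>m y. of_real (c m) * cf (q ^ m) y" and ?B = "\<lambda>n y. of_real (d n) * cf (q ^ n) y"
    let ?b = "\<lambda>n. \<bar>d n\<bar> * r ^ n"
    \<comment> \<open>The first series is absolutely summable in \<open>m\<close> and
      \<open>y\<close> together and the second is bounded by \<open>?b n\<close> uniformly in its
      site, so this product dominates the triple family.\<close>
    have "(\<lambda>(my,n). norm (case my of (m,y) \<Rightarrow> ?A m y) * ?b n) summable_on (UNIV \<times> UNIV)"
      using pser_summable_abs[OF c] d r0 unfolding admissible_def
      by (intro summable_on_times_nonneg) (auto simp: case_prod_unfold)
    then have "(\<lambda>((m,y),n). norm (?A m y) * ?b n) summable_on UNIV"
      by (simp add: case_prod_unfold)
    moreover have "bij_betw (\<lambda>(y,(m,n)). ((m,y),n)) UNIV UNIV"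
      by (rule bij_betwI[where g="\<lambda>((m,y),n). (y,(m,n))"]) auto
    ultimately have "(\<lambda>(y,(m,n)). norm (?A m y) * ?b n) summable_on UNIV"
      using summable_on_reindex_bij_betw[of "\<lambda>(y,(m,n)). ((m,y),n)" UNIV UNIV "\<lambda>((m,y),n). norm (?A m y) * ?b n"]
      by (simp add: case_prod_unfold)
    then have "(\<lambda>(y,(m,n)). norm (?A m y * ?B n (x - y))) summable_on UNIV"
      by (rule summable_on_le) (auto simp: norm_mult intro!: mult_left_mono cf_power_le)
    then have s: "(\<lambda>(y,(m,n)). ?A m y * ?B n (x - y)) summable_on (UNIV \<times> UNIV)"
      unfolding UNIV_Times_UNIV case_prod_unfold by (rule abs_summable_summable)
    have s1: "(\<lambda>(m,n). ?A m y * ?B n (x - y)) summable_on (UNIV \<times> UNIV)" for y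
      using summable_on_SigmaD1[OF s, of y] by simp
    have "(\<lambda>(m,n). (\<bar>c m\<bar> * r ^ m) * (\<bar>d n\<bar> * r ^ n)) summable_on (UNIV \<times> UNIV)"
      using c d r0 unfolding admissible_def by (intro summable_on_times_nonneg) auto
    then have s2: "(\<lambda>(m,n). norm (of_real (c m * d n) * cf (q ^ (m + n)) x)) summable_on (UNIV \<times> UNIV)"
    proof (rule summable_on_le, goal_cases)
      case (2 z)
      obtain m n where z: "z = (m, n)" by (cases z)
      have "\<bar>c m * d n\<bar> * norm (cf (q ^ (m + n)) x) \<le> \<bar>c m * d n\<bar> * r ^ (m + n)"
        by (intro mult_left_mono cf_power_le) auto
      then show ?case by (simp add: z norm_mult power_add abs_mult mult_ac)
    qed auto
    define f where "f = (\<lambda>(m,n). of_real (c m * d n) * cf (q ^ (m + n)) x)"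
    have s2: "f summable_on UNIV"
      unfolding f_def case_prod_unfold by (rule abs_summable_summable) (use s2 in \<open>simp add: case_prod_unfold\<close>)
    \<comment> \<open>Natural subtraction is harmless on the triangle \<open>i \<le> k\<close>,
      where \<open>?p\<close> enumerates all pairs by their sum.\<close>
    let ?p = "\<lambda>(k::nat,i::nat). (i, k - i)"
    have bij: "bij_betw ?p (SIGMA k:UNIV. {..k}) UNIV"
      by (rule bij_betwI[where g="\<lambda>(m,n). (m+n, m)"]) auto
    have eq: "f (?p z) = (case z of (k,i) \<Rightarrow> of_real (c i * d (k - i)) * cf (q ^ k) x)"
      if "z \<in> (SIGMA k:UNIV. {..k})" for z using that by (auto simp: f_def)
    have "(\<lambda>z. f (?p z)) summable_on (SIGMA k:UNIV. {..k})"
      by (rule iffD2[OF summable_on_reindex_bij_betw[OF bij] s2])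
    then have s3: "(\<lambda>(k,i). of_real (c i * d (k - i)) * cf (q ^ k) x) summable_on (SIGMA k:UNIV. {..k})"
      by (rule summable_on_cong[THEN iffD1, rotated]) (rule eq)
    have sf: "infsum f UNIV = (\<Sum>\<^sub>\<infinity>(k,i)\<in>(SIGMA k:UNIV. {..k}). of_real (c i * d (k - i)) * cf (q ^ k) x)"
      unfolding infsum_reindex_bij_betw[OF bij, of f, symmetric] by (rule infsum_cong[OF eq])
    have "cf (pser q c * pser q d) x = (\<Sum>\<^sub>\<infinity>y. \<Sum>\<^sub>\<infinity>m. \<Sum>\<^sub>\<infinity>n. ?A m y * ?B n (x - y))"
      unfolding cf_times cf_pser[OF c] cf_pser[OF d] by (simp only: infsum_cmult_left' infsum_cmult_right')
    also have "\<dots> = (\<Sum>\<^sub>\<infinity>y. \<Sum>\<^sub>\<infinity>(m,n). ?A m y * ?B n (x - y))"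
      by (rule infsum_cong) (use infsum_Sigma'_banach[OF s1] in simp)
    also have "\<dots> = (\<Sum>\<^sub>\<infinity>mn. \<Sum>\<^sub>\<infinity>y. case mn of (m,n) \<Rightarrow> ?A m y * ?B n (x - y))"
      using infsum_swap_banach[OF s] by simp
    also have "\<dots> = (\<Sum>\<^sub>\<infinity>(m,n). of_real (c m * d n) * cf (q ^ (m + n)) x)"
    proof (rule infsum_cong)
      fix mn :: "nat \<times> nat"
      obtain m n where mn: "mn = (m,n)" by (cases mn)
      have "(\<Sum>\<^sub>\<infinity>y. ?A m y * ?B n (x - y)) = (\<Sum>\<^sub>\<infinity>y. of_real (c m * d n) * (cf (q ^ m) y * cf (q ^ n) (x - y)))"
        by (rule infsum_cong) (simp add: mult_ac)
      also have "\<dots> = of_real (c m * d n) * cf (q ^ m * q ^ n) x"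
        by (simp only: infsum_cmult_right' cf_times)
      finally show "(\<Sum>\<^sub>\<infinity>y. case mn of (m,n) \<Rightarrow> ?A m y * ?B n (x - y))
          = (case mn of (m,n) \<Rightarrow> of_real (c m * d n) * cf (q ^ (m + n)) x)"
        by (simp add: mn power_add)
    qed
    also have "\<dots> = (\<Sum>\<^sub>\<infinity>(k,i)\<in>(SIGMA k:UNIV. {..k}). of_real (c i * d (k - i)) * cf (q ^ k) x)"
      using sf unfolding f_def .
    also have "\<dots> = (\<Sum>\<^sub>\<infinity>k. \<Sum>i\<le>k. of_real (c i * d (k - i)) * cf (q ^ k) x)"
      using infsum_Sigma'_banach[OF s3] by simp
    finally show ?thesis by (simp add: sum_distrib_right)
  qed
  \<comment> \<open>The right-hand side is \<open>Abs_expseq\<close> of a function just recognised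
    as the coefficients of an \<open>expseq\<close>; this replaces a proof that the Cauchy product
    is admissible.\<close>
  then show ?thesis unfolding pser_def by (metis (no_types, lifting) cf.rep_eq Rep_expseq_inverse ext)
qed

lemma pser_finite:
  assumes "\<And>n. n > m \<Longrightarrow> c n = 0"
  shows "cf (pser q c) x = (\<Sum>n\<le>m. of_real (c n) * cf (q ^ n) x)"
proof -
  have "admissible c" unfolding admissible_def
    by (rule finite_nonzero_values_imp_summable_on, rule finite_subset[of _ "{..m}"])
      (use assms not_less in auto)
  then have "cf (pser q c) x = (\<Sum>\<^sub>\<infinity>n. of_real (c n) * cf (q ^ n) x)" by (rule cf_pser)
  also have "\<dots> = (\<Sum>\<^sub>\<infinity>n\<in>{..m}. of_real (c n) * cf (q ^ n) x)"
    by (rule infsum_cong_neutral) (use assms not_less in auto)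
  finally show ?thesis by simp
qed

lemma star_pser:
  assumes "admissible c" "star q = q"
  shows "star (pser q c) = pser q c"
proof (rule expseq_eqI)
  fix x
  have "cnj (cf (q ^ n) (- x)) = cf (q ^ n) x" for n
    using cf_star[of "q ^ n" x] by (simp add: star_power assms(2))
  then show "cf (star (pser q c)) x = cf (pser q c) x"
    by (simp add: cf_star cf_pser[OF assms(1)] flip: infsum_cnj)
qed

text \<open>The radius of convergence is at least 1: infinite when the exponent is a natural number
  and exactly 1 otherwise.\<close>

lemma admissible_gbinomial:
  assumes "r < 1"
  shows "admissible (\<lambda>n. \<alpha> gchoose n)"
proof -
  have r0: "0 \<le> r" unfolding r by (rule wnorm_nonneg) (use q in auto)
  have "conv_radius (\<lambda>n. \<alpha> gchoose n) \<ge> 1"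
    using conv_radius_gchoose[of \<alpha>] by (auto split: if_splits)
  moreover have "ereal (norm r) < 1" using assms r0 by simp
  ultimately have "ereal (norm r) < conv_radius (\<lambda>n. \<alpha> gchoose n)" by (rule less_le_trans[rotated])
  then have "summable (\<lambda>n. norm ((\<alpha> gchoose n) * r ^ n))" by (rule abs_summable_in_conv_radius)
  then have "(\<lambda>n. (\<alpha> gchoose n) * r ^ n) summable_on UNIV" by (rule norm_summable_imp_summable_on)
  then show ?thesis unfolding admissible_def
    by (subst (asm) summable_on_iff_abs_summable_on_real) (use r0 in \<open>simp add: abs_mult\<close>)
qed

end

text \<open>Newton's series for \<open>1 + q\<close> raised to the real exponent
  \<open>\<alpha>\<close>.\<close>

definition binser :: "expseq \<Rightarrow> real \<Rightarrow> expseq" where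
  "binser q \<alpha> = pser q (\<lambda>n. \<alpha> gchoose n)"

context
  fixes q :: expseq and \<rho> :: real
  assumes q: "1 < \<rho>" "wsum \<rho> (cf q)" "wnorm \<rho> (cf q) < 1"
begin

text \<open>Vandermonde's convolution is the law of exponents for \<open>1 + q\<close>. Together
  with the exponents 0 and 1 it turns the series into genuine roots and inverses.\<close>

lemma binser_mult: "binser q \<alpha> * binser q \<beta> = binser q (\<alpha> + \<beta>)"
  unfolding binser_def
  using pser_mult[OF q(1,2) refl admissible_gbinomial[OF q(1,2) refl q(3)] admissible_gbinomial[OF q(1,2) refl q(3)]]
  by (simp add: gbinomial_Vandermonde[unfolded atLeast0AtMost])

lemma star_binser: "star q = q \<Longrightarrow> star (binser q \<alpha>) = binser q \<alpha>"
  unfolding binser_def by (rule star_pser[OF q(1,2) refl admissible_gbinomial[OF q(1,2) refl q(3)]])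

lemma binser_0: "binser q 0 = 1"
proof (rule expseq_eqI)
  show "cf (binser q 0) x = cf 1 x" for x
    unfolding binser_def by (subst pser_finite[OF q(1,2) refl, of 0]) (auto simp: gr0_conv_Suc)
qed

lemma binser_1: "binser q 1 = 1 + q"
proof (rule expseq_eqI)
  have "(1::real) gchoose n = 0" if "n > 1" for n
    using that binomial_eq_0[of 1 n] binomial_gbinomial[of 1 n, where 'a=real]
    by (metis of_nat_0 of_nat_1)
  then show "cf (binser q 1) x = cf (1 + q) x" for x
    unfolding binser_def by (subst pser_finite[OF q(1,2) refl, of 1]) auto
qed

end

section \<open>Translation-invariant operators on \<open>l2\<close>\<close>

type_synonym symbol = "expseq^2^2"

definition ker :: "symbol \<Rightarrow> kernel" where
  "ker \<kappa> x y = (\<chi> i j. cf (\<kappa> $ i $ j) (x - y))"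

text \<open>A scalar l1 majorant of all four entries; it reduces operator estimates to scalar
  convolutions with \<open>dom \<kappa>\<close>.\<close>

definition dom :: "symbol \<Rightarrow> site \<Rightarrow> real" where
  "dom \<kappa> z = (\<Sum>i\<in>UNIV. \<Sum>j\<in>UNIV. norm (cf (\<kappa> $ i $ j) z))"

lemma norm_vec_le_sum: "norm (v :: 'a::real_normed_vector^'n) \<le> (\<Sum>i\<in>UNIV. norm (v $ i))"
  unfolding norm_vec_def by (rule L2_set_le_sum) auto

lemma norm_mult_vec_le:
  fixes A :: "complex^'n^'m"
  shows "norm (A *v v) \<le> (\<Sum>i\<in>UNIV. \<Sum>j\<in>UNIV. norm (A $ i $ j)) * norm v"
proof -
  have "norm (A *v v) \<le> (\<Sum>i\<in>UNIV. norm ((A *v v) $ i))" by (rule norm_vec_le_sum)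
  also have "\<dots> \<le> (\<Sum>i\<in>UNIV. \<Sum>j\<in>UNIV. norm (A $ i $ j) * norm v)"
    unfolding matrix_vector_mult_def vec_lambda_beta
    by (rule sum_mono, rule order_trans[OF norm_sum], rule sum_mono)
      (auto simp: norm_mult intro!: mult_left_mono Finite_Cartesian_Product.norm_nth_le)
  finally show ?thesis by (simp add: sum_distrib_right)
qed

lemma norm_ker_le: "norm (ker \<kappa> x y) \<le> dom \<kappa> (x - y)"
proof -
  have "norm (ker \<kappa> x y) \<le> (\<Sum>i\<in>UNIV. norm (ker \<kappa> x y $ i))" by (rule norm_vec_le_sum)
  also have "\<dots> \<le> (\<Sum>i\<in>UNIV. \<Sum>j\<in>UNIV. norm (ker \<kappa> x y $ i $ j))" by (rule sum_mono[OF norm_vec_le_sum])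
  finally show ?thesis by (simp add: ker_def dom_def)
qed

lemma norm_ker_mult_le: "norm (ker \<kappa> x y *v v) \<le> dom \<kappa> (x - y) * norm v"
  using norm_mult_vec_le[of "ker \<kappa> x y" v] by (simp add: ker_def dom_def)

lemma dom_nonneg [simp]: "0 \<le> dom \<kappa> z"
  unfolding dom_def by (intro sum_nonneg) auto

lemma has_sum_sum:
  fixes f :: "'a \<Rightarrow> 'b \<Rightarrow> 'c::topological_comm_monoid_add"
  assumes "finite I" "\<And>i. i \<in> I \<Longrightarrow> (f i has_sum s i) A"
  shows "((\<lambda>x. \<Sum>i\<in>I. f i x) has_sum (\<Sum>i\<in>I. s i)) A"
  using assms by (induction I rule: finite_induct) (auto intro!: has_sum_add)

lemma summable_on_sum:
  fixes f :: "'a \<Rightarrow> 'b \<Rightarrow> 'c::{topological_comm_monoid_add,t2_space}"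
  assumes "finite I" "\<And>i. i \<in> I \<Longrightarrow> f i summable_on A"
  shows "(\<lambda>x. \<Sum>i\<in>I. f i x) summable_on A"
  using assms by (intro has_sum_imp_summable[OF has_sum_sum[where s="\<lambda>i. infsum (f i) A"]]) auto

lemma has_sum_vecI:
  fixes f :: "'a \<Rightarrow> ('b::{topological_comm_monoid_add})^'n"
  assumes "\<And>i. ((\<lambda>x. f x $ i) has_sum S $ i) A"
  shows "(f has_sum S) A"
  using assms unfolding has_sum_def by (intro vec_tendstoI) (simp add: sum_component)

lemma dom_summable: "dom \<kappa> summable_on UNIV"
  unfolding dom_def[abs_def] by (intro summable_on_sum cf_summable) auto

text \<open>Kernels with an l1 majorant act on all bounded waves by absolutely convergent sums;
  subtraction and composition are proved at this level and then used on l2.\<close>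

definition wave_bounded :: "wave \<Rightarrow> bool" where
  "wave_bounded u \<longleftrightarrow> (\<exists>M. \<forall>x. norm (u x) \<le> M)"

lemma l2_wave_bounded: "u \<in> l2 \<Longrightarrow> wave_bounded u"
  unfolding wave_bounded_def
proof (intro exI allI)
  fix x assume "u \<in> l2"
  then have "norm ((norm (u x))\<^sup>2) \<le> (\<Sum>\<^sub>\<infinity>x. norm ((norm (u x))\<^sup>2))"
    by (intro norm_le_infsum_norm) (simp add: l2_def)
  then show "norm (u x) \<le> sqrt (\<Sum>\<^sub>\<infinity>x. (norm (u x))\<^sup>2)"
    by (intro real_le_rsqrt) simp
qed

lemma bij_sub: "bij_betw (\<lambda>y. x - y) UNIV (UNIV :: 'g::ab_group_add set)"
  by (rule bij_betwI[where g="\<lambda>y. x - y"]) auto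

lemma dom_shift: "(\<lambda>y. dom \<kappa> (x - y)) summable_on UNIV" "(\<Sum>\<^sub>\<infinity>y. dom \<kappa> (x - y)) = infsum (dom \<kappa>) UNIV"
  using summable_on_reindex_bij_betw[OF bij_sub] dom_summable infsum_reindex_bij_betw[OF bij_sub]
  by metis+

lemma ker_summable:
  assumes "wave_bounded u"
  shows "(\<lambda>y. norm (ker \<kappa> x y *v u y)) summable_on UNIV" "(\<lambda>y. ker \<kappa> x y *v u y) summable_on UNIV"
proof -
  obtain M where M: "\<And>x. norm (u x) \<le> M" using assms unfolding wave_bounded_def by blast
  show "(\<lambda>y. norm (ker \<kappa> x y *v u y)) summable_on UNIV"
  proof (rule summable_on_le)
    show "(\<lambda>y. dom \<kappa> (x - y) * M) summable_on UNIV" by (rule summable_on_cmult_left[OF dom_shift(1)])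
    show "norm (ker \<kappa> x y *v u y) \<le> dom \<kappa> (x - y) * M" for y
      using norm_ker_mult_le[of \<kappa> x y "u y"] mult_left_mono[OF M[of y] dom_nonneg[of \<kappa> "x - y"]] by linarith
  qed auto
  then show "(\<lambda>y. ker \<kappa> x y *v u y) summable_on UNIV" by (rule abs_summable_summable)
qed

text \<open>Schur's test: Cauchy-Schwarz for the weights \<open>dom \<kappa> (x - y)\<close>,
  followed by summation over \<open>x\<close>.\<close>

lemma kapp_ker_l2:
  assumes u: "u \<in> l2"
  shows "kapp (ker \<kappa>) u \<in> l2" "l2norm (kapp (ker \<kappa>) u) \<le> (infsum (dom \<kappa>) UNIV + 1) * l2norm u"
proof -
  \<comment> \<open>The added 1 keeps \<open>M\<close> positive, so that \<open>A / M\<close> below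
    is a legitimate choice even for the zero symbol.\<close>
  define M where "M = infsum (dom \<kappa>) UNIV + 1"
  have M: "M > 0" unfolding M_def by (intro add_nonneg_pos infsum_nonneg) auto
  note b = l2_wave_bounded[OF u]
  obtain U where U: "\<And>x. norm (u x) \<le> U" using b unfolding wave_bounded_def by blast
  have u2: "(\<lambda>x. (norm (u x))\<^sup>2) summable_on UNIV" using u unfolding l2_def by simp
  note c = infsum_conv_nonneg[OF u2 _ dom_summable dom_nonneg[of \<kappa>]]
  define B where "B x = (\<Sum>\<^sub>\<infinity>y. (norm (u y))\<^sup>2 * dom \<kappa> (x - y))" for x
  have le: "(norm (kapp (ker \<kappa>) u x))\<^sup>2 \<le> M * B x" for x
  proof -
    define A where "A = (\<Sum>\<^sub>\<infinity>y. dom \<kappa> (x - y) * norm (u y))"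
    have sA: "(\<lambda>y. dom \<kappa> (x - y) * norm (u y)) summable_on UNIV"
      by (rule summable_on_le[OF summable_on_cmult_left[OF dom_shift(1)[of \<kappa> x], of U]])
        (auto intro: mult_left_mono U)
    have nA: "norm (kapp (ker \<kappa>) u x) \<le> A"
      unfolding kapp_def A_def using norm_infsum_bound[OF ker_summable(1)[OF b]]
      by (rule order_trans) (rule infsum_mono[OF ker_summable(1)[OF b] sA norm_ker_mult_le])
    \<comment> \<open>Cauchy-Schwarz through a quadratic polynomial in \<open>t\<close>, bounded
      below by the weighted sum of \<open>(norm (u y) - t)\<^sup>2\<close>; the choice
      \<open>A / M\<close> minimises it.\<close>
    have "0 \<le> B x - 2 * t * A + t\<^sup>2 * M" for t
    proof -
      have "(\<lambda>y. (norm (u y))\<^sup>2 * dom \<kappa> (x - y) + (- 2 * t) * (dom \<kappa> (x - y) * norm (u y)) + t\<^sup>2 * dom \<kappa> (x - y))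
        = (\<lambda>y. dom \<kappa> (x - y) * (norm (u y) - t)\<^sup>2)"
        by (rule ext) (simp add: power2_eq_square algebra_simps)
      moreover have "((\<lambda>y. (norm (u y))\<^sup>2 * dom \<kappa> (x - y) + (- 2 * t) * (dom \<kappa> (x - y) * norm (u y)) + t\<^sup>2 * dom \<kappa> (x - y))
          has_sum (B x + (- 2 * t) * A + t\<^sup>2 * infsum (dom \<kappa>) UNIV)) UNIV"
        unfolding B_def A_def dom_shift(2)[of \<kappa> x, symmetric]
        using c(3)[of x] sA dom_shift(1)[of \<kappa> x]
        by (intro has_sum_add has_sum_cmult_right has_sum_infsum) auto
      ultimately have "0 \<le> B x + (- 2 * t) * A + t\<^sup>2 * infsum (dom \<kappa>) UNIV"
        by (metis (no_types, lifting) dom_nonneg has_sum_nonneg mult_nonneg_nonneg zero_le_power2)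
      then show ?thesis unfolding M_def by (simp add: algebra_simps) (smt (verit) zero_le_power2)
    qed
    from this[of "A / M"] have "A\<^sup>2 \<le> M * B x" using M by (simp add: power2_eq_square field_simps)
    moreover have "(norm (kapp (ker \<kappa>) u x))\<^sup>2 \<le> A\<^sup>2" by (rule power_mono[OF nA]) simp
    ultimately show ?thesis by linarith
  qed
  have sB: "(\<lambda>x. M * B x) summable_on UNIV" unfolding B_def by (rule summable_on_cmult_right) (rule c(1), simp)
  have s: "(\<lambda>x. (norm (kapp (ker \<kappa>) u x))\<^sup>2) summable_on UNIV"
    by (rule summable_on_le[OF sB _ le]) simp
  then show "kapp (ker \<kappa>) u \<in> l2" unfolding l2_def by simp
  let ?N = "\<Sum>\<^sub>\<infinity>x. (norm (u x))\<^sup>2"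
  have N: "0 \<le> ?N" by (rule infsum_nonneg) simp
  have "(\<Sum>\<^sub>\<infinity>x. (norm (kapp (ker \<kappa>) u x))\<^sup>2) \<le> (\<Sum>\<^sub>\<infinity>x. M * B x)"
    by (rule infsum_mono[OF s sB le])
  also have "\<dots> = M * (?N * infsum (dom \<kappa>) UNIV)"
    unfolding B_def infsum_cmult_right' by (subst c(2)) auto
  also have "\<dots> \<le> M * (?N * M)" using M N by (intro mult_left_mono) (auto simp: M_def)
  finally have "l2norm (kapp (ker \<kappa>) u) \<le> sqrt (M\<^sup>2 * ?N)"
    unfolding l2norm_def by (simp add: power2_eq_square mult_ac)
  also have "\<dots> = M * l2norm u" unfolding l2norm_def using M by (simp add: real_sqrt_mult)
  finally show "l2norm (kapp (ker \<kappa>) u) \<le> (infsum (dom \<kappa>) UNIV + 1) * l2norm u" unfolding M_def .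
qed

lemma bounded_kernel_ker: "bounded_kernel (ker \<kappa>)"
  unfolding bounded_kernel_def using kapp_ker_l2 by blast

lemma l2_add:
  assumes "u \<in> l2" "v \<in> l2"
  shows "(\<lambda>x. u x + v x) \<in> l2"
  unfolding l2_def mem_Collect_eq
proof (rule summable_on_le)
  show "(\<lambda>x. 2 * (norm (u x))\<^sup>2 + 2 * (norm (v x))\<^sup>2) summable_on UNIV"
    using assms unfolding l2_def by (auto intro: summable_on_add summable_on_cmult_right)
  show "(norm (u x + v x))\<^sup>2 \<le> 2 * (norm (u x))\<^sup>2 + 2 * (norm (v x))\<^sup>2" for x
  proof -
    have "(norm (u x + v x))\<^sup>2 \<le> (norm (u x) + norm (v x))\<^sup>2" by (rule power_mono[OF norm_triangle_ineq]) simp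
    moreover have "0 \<le> (norm (u x) - norm (v x))\<^sup>2" by simp
    ultimately show ?thesis by (simp add: power2_eq_square algebra_simps)
  qed
qed auto

lemma l2_uminus: "u \<in> l2 \<Longrightarrow> (\<lambda>x. - u x) \<in> l2"
  unfolding l2_def by simp

lemma l2_diff: "u \<in> l2 \<Longrightarrow> v \<in> l2 \<Longrightarrow> (\<lambda>x. u x - v x) \<in> l2"
  using l2_add[of u "\<lambda>x. - v x"] l2_uminus[of v] by simp

lemma l2_zero: "(\<lambda>x. 0) \<in> l2"
  unfolding l2_def by simp

lemma kapp_diff:
  assumes "wave_bounded u" "wave_bounded v"
  shows "kapp (ker \<kappa>) (\<lambda>x. u x - v x) = (\<lambda>x. kapp (ker \<kappa>) u x - kapp (ker \<kappa>) v x)"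
proof
  fix x
  have "((\<lambda>y. ker \<kappa> x y *v u y + - (ker \<kappa> x y *v v y)) has_sum
      (kapp (ker \<kappa>) u x + - kapp (ker \<kappa>) v x)) UNIV"
    unfolding kapp_def using ker_summable(2)[OF assms(1)] ker_summable(2)[OF assms(2)]
    by (intro has_sum_add has_sum_uminus[THEN iffD2] has_sum_infsum) auto
  then show "kapp (ker \<kappa>) (\<lambda>x. u x - v x) x = kapp (ker \<kappa>) u x - kapp (ker \<kappa>) v x"
    unfolding kapp_def by (intro infsumI) (simp add: matrix_vector_mult_diff_distrib)
qed

lemma kapp_ker_diff:
  assumes "wave_bounded u"
  shows "kapp (ker (\<kappa> - \<mu>)) u = (\<lambda>x. kapp (ker \<kappa>) u x - kapp (ker \<mu>) u x)"
proof
  fix x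
  have eq: "ker (\<kappa> - \<mu>) x y = ker \<kappa> x y - ker \<mu> x y" for y
    by (simp add: ker_def vec_eq_iff)
  have "((\<lambda>y. ker \<kappa> x y *v u y + - (ker \<mu> x y *v u y)) has_sum
      (kapp (ker \<kappa>) u x + - kapp (ker \<mu>) u x)) UNIV"
    unfolding kapp_def using ker_summable(2)[OF assms]
    by (intro has_sum_add has_sum_uminus[THEN iffD2] has_sum_infsum) auto
  then show "kapp (ker (\<kappa> - \<mu>)) u x = kapp (ker \<kappa>) u x - kapp (ker \<mu>) u x"
    unfolding kapp_def eq by (intro infsumI) (simp add: matrix_vector_mult_diff_rdistrib)
qed

lemma ker_mat_1: "ker (mat 1) x y = (if x = y then mat 1 else 0)"
  by (simp add: ker_def mat_def vec_eq_iff cf_one)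

lemma kapp_ker_mat_1: "kapp (ker (mat 1)) u = u"
proof
  fix x
  have "kapp (ker (mat 1)) u x = (\<Sum>\<^sub>\<infinity>y\<in>{x}. ker (mat 1) x y *v u y)"
    unfolding kapp_def by (rule infsum_cong_neutral) (auto simp: ker_mat_1)
  then show "kapp (ker (mat 1)) u x = u x" by (simp add: ker_mat_1)
qed

section \<open>Composition of translation-invariant operators\<close>

lemma bounded_linear_mult_vec: "bounded_linear (\<lambda>A :: complex^2^2. A *v v)"
  unfolding linear_conv_bounded_linear[symmetric]
  by (rule linearI) (auto simp: vec_eq_iff matrix_vector_mult_def scaleR_sum_right algebra_simps sum.distrib)

lemma bounded_linear_mult_vec2: "bounded_linear (\<lambda>v. (A :: complex^2^2) *v v)"
  unfolding linear_conv_bounded_linear[symmetric]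
  by (rule linearI) (auto simp: vec_eq_iff matrix_vector_mult_def scaleR_sum_right algebra_simps sum.distrib)

lemma bij_composition: "bij_betw (\<lambda>(y,z). (x - y, y - z)) UNIV (UNIV :: ('g::ab_group_add \<times> 'g) set)"
  by (rule bij_betwI[where g="\<lambda>(a,b). (x - a, x - a - b)"]) auto

lemma summable_composition:
  fixes f g :: "'g::ab_group_add \<Rightarrow> real"
  assumes "f summable_on UNIV" "\<And>x. 0 \<le> f x" "g summable_on UNIV" "\<And>x. 0 \<le> g x"
  shows "(\<lambda>(y,z). f (x - y) * g (y - z)) summable_on UNIV"
  using summable_on_reindex_bij_betw[OF bij_composition, of "\<lambda>(y,z). f y * g z" x]
    summable_on_times_nonneg[of f UNIV g UNIV] assms by (simp add: case_prod_unfold)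

lemma cf_sum: "cf (sum f I) x = (\<Sum>i\<in>I. cf (f i) x)"
  by (induction I rule: infinite_finite_induct) auto

lemma cf_times': "(\<Sum>\<^sub>\<infinity>y. cf a (x - y) * cf b (y - z)) = cf (a * b) (x - z)"
  and cf_times'_summable: "(\<lambda>y. cf a (x - y) * cf b (y - z)) summable_on UNIV"
proof -
  let ?f = "\<lambda>y. cf a y * cf b (x - z - y)"
  have eq: "cf a (x - y) * cf b (y - z) = ?f (x - y)" for y by (simp add: algebra_simps)
  show "(\<Sum>\<^sub>\<infinity>y. cf a (x - y) * cf b (y - z)) = cf (a * b) (x - z)"
    unfolding eq infsum_reindex_bij_betw[OF bij_sub, of ?f] by (simp add: cf_times)
  show "(\<lambda>y. cf a (x - y) * cf b (y - z)) summable_on UNIV"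
    unfolding eq summable_on_reindex_bij_betw[OF bij_sub, of ?f]
    by (rule conv_summable(2)[OF cf_summable cf_summable])
qed

lemma ker_compose: "((\<lambda>y. ker \<kappa> x y ** ker \<mu> y z) has_sum ker (\<kappa> ** \<mu>) x z) UNIV"
proof (intro has_sum_vecI)
  fix i j
  have "((\<lambda>y. \<Sum>k\<in>UNIV. cf (\<kappa> $ i $ k) (x - y) * cf (\<mu> $ k $ j) (y - z))
      has_sum (\<Sum>k\<in>UNIV. cf (\<kappa> $ i $ k * \<mu> $ k $ j) (x - z))) UNIV"
    by (rule has_sum_sum) (auto simp: has_sum_iff cf_times' cf_times'_summable)
  then show "((\<lambda>y. (ker \<kappa> x y ** ker \<mu> y z) $ i $ j) has_sum ker (\<kappa> ** \<mu>) x z $ i $ j) UNIV"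
    by (simp add: ker_def matrix_matrix_mult_def cf_sum)
qed

text \<open>Composing operators amounts to multiplying symbols, so \<open>P\<^sup>2 = P\<close>
  becomes a ring identity. Fubini applies because the double sum is dominated by a convolution of
  the two majorants times a bound for \<open>u\<close>.\<close>

lemma kapp_compose:
  assumes "wave_bounded u"
  shows "kapp (ker \<kappa>) (kapp (ker \<mu>) u) = kapp (ker (\<kappa> ** \<mu>)) u"
proof
  fix x
  obtain M where M: "\<And>x. norm (u x) \<le> M" using assms unfolding wave_bounded_def by blast
  have M0: "0 \<le> M" using M[of 0] norm_ge_zero order_trans by blast
  have "(\<lambda>(y,z). norm (ker \<kappa> x y *v (ker \<mu> y z *v u z))) summable_on UNIV"
  proof (rule summable_on_le)
    show "(\<lambda>(y,z). dom \<kappa> (x - y) * dom \<mu> (y - z) * M) summable_on UNIV"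
      using summable_on_cmult_left[OF summable_composition[OF dom_summable[of \<kappa>] _ dom_summable[of \<mu>]], of x M]
      by (simp add: case_prod_unfold)
    fix yz :: "site \<times> site"
    obtain y z where yz: "yz = (y,z)" by (cases yz)
    have "norm (ker \<kappa> x y *v (ker \<mu> y z *v u z)) \<le> dom \<kappa> (x - y) * norm (ker \<mu> y z *v u z)"
      by (rule norm_ker_mult_le)
    also have "\<dots> \<le> dom \<kappa> (x - y) * (dom \<mu> (y - z) * M)"
      by (intro mult_left_mono order_trans[OF norm_ker_mult_le] M) auto
    finally show "(case yz of (y,z) \<Rightarrow> norm (ker \<kappa> x y *v (ker \<mu> y z *v u z)))
        \<le> (case yz of (y,z) \<Rightarrow> dom \<kappa> (x - y) * dom \<mu> (y - z) * M)"
      by (simp add: yz mult.assoc)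
  qed auto
  then have s: "(\<lambda>(y,z). ker \<kappa> x y *v (ker \<mu> y z *v u z)) summable_on (UNIV \<times> UNIV)"
    unfolding UNIV_Times_UNIV case_prod_unfold by (rule abs_summable_summable)
  have "kapp (ker \<kappa>) (kapp (ker \<mu>) u) x = (\<Sum>\<^sub>\<infinity>y. \<Sum>\<^sub>\<infinity>z. ker \<kappa> x y *v (ker \<mu> y z *v u z))"
    unfolding kapp_def
    by (rule infsum_cong, rule infsumI[symmetric], rule has_sum_bounded_linear[OF bounded_linear_mult_vec2],
        rule has_sum_infsum, rule ker_summable(2)[OF assms])
  also have "\<dots> = (\<Sum>\<^sub>\<infinity>z. \<Sum>\<^sub>\<infinity>y. ker \<kappa> x y *v (ker \<mu> y z *v u z))"
    by (rule infsum_swap_banach[OF s])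
  also have "\<dots> = kapp (ker (\<kappa> ** \<mu>)) u x"
    unfolding kapp_def matrix_vector_mul_assoc
    by (rule infsum_cong, rule infsumI, rule has_sum_bounded_linear[OF bounded_linear_mult_vec], rule ker_compose)
  finally show "kapp (ker \<kappa>) (kapp (ker \<mu>) u) x = kapp (ker (\<kappa> ** \<mu>)) u x" .
qed

section \<open>Inner products\<close>

definition hinner :: "complex^2 \<Rightarrow> complex^2 \<Rightarrow> complex" where
  "hinner a b = (\<Sum>i\<in>UNIV. cnj (a $ i) * b $ i)"

lemma l2inner_eq: "l2inner u v = (\<Sum>\<^sub>\<infinity>x. hinner (u x) (v x))"
  unfolding l2inner_def hinner_def ..

lemma norm_hinner_le: "norm (hinner a b) \<le> 2 * (norm a * norm b)"
proof -
  have "norm (cnj (a $ i) * b $ i) \<le> norm a * norm b" for i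
    by (simp add: norm_mult mult_mono Finite_Cartesian_Product.norm_nth_le)
  from sum_norm_le[of UNIV "\<lambda>i. cnj (a $ i) * b $ i", OF this] show ?thesis
    unfolding hinner_def by simp
qed

lemma norm_hinner_le_squares: "norm (hinner a b) \<le> (norm a)\<^sup>2 + (norm b)\<^sup>2"
  using norm_hinner_le[of a b] sum_squares_bound[of "norm a" "norm b"] by simp

lemma hinner_self: "hinner a a = of_real ((norm a)\<^sup>2)"
proof -
  have "hinner a a = of_real (\<Sum>i\<in>UNIV. (norm (a $ i))\<^sup>2)"
    unfolding hinner_def by (simp add: complex_norm_square mult.commute del: of_real_power)
  also have "(\<Sum>i\<in>UNIV. (norm (a $ i))\<^sup>2) = (norm a)\<^sup>2"
    unfolding norm_vec_def L2_set_def by (simp add: sum_nonneg)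
  finally show ?thesis .
qed

lemma hinner_add_left: "hinner (a + b) c = hinner a c + hinner b c"
  and hinner_minus_right: "hinner c (- a) = - hinner c a"
  by (simp_all add: hinner_def algebra_simps sum.distrib sum_subtractf sum_negf)

lemma bounded_linear_hinner_left: "bounded_linear (\<lambda>a. hinner a b)"
  unfolding linear_conv_bounded_linear[symmetric]
  by (rule linearI) (simp_all add: hinner_def algebra_simps sum.distrib scaleR_sum_right)

lemma bounded_linear_hinner_right: "bounded_linear (hinner a)"
  unfolding linear_conv_bounded_linear[symmetric]
  by (rule linearI) (simp_all add: hinner_def algebra_simps sum.distrib scaleR_sum_right)

lemma l2inner_summable:
  assumes "u \<in> l2" "v \<in> l2"
  shows "(\<lambda>x. hinner (u x) (v x)) summable_on UNIV"
proof (rule abs_summable_summable, rule summable_on_le)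
  show "(\<lambda>x. (norm (u x))\<^sup>2 + (norm (v x))\<^sup>2) summable_on UNIV"
    using assms unfolding l2_def by (auto intro: summable_on_add)
qed (auto intro: norm_hinner_le_squares)

lemma l2inner_add_left:
  "u \<in> l2 \<Longrightarrow> v \<in> l2 \<Longrightarrow> w \<in> l2 \<Longrightarrow> l2inner (\<lambda>x. u x + v x) w = l2inner u w + l2inner v w"
  unfolding l2inner_eq hinner_add_left by (intro infsum_add l2inner_summable)

lemma l2inner_diff_left:
  assumes "u \<in> l2" "v \<in> l2" "w \<in> l2"
  shows "l2inner (\<lambda>x. u x - v x) w = l2inner u w - l2inner v w"
  using l2inner_add_left[OF l2_diff[OF assms(1,2)] assms(2,3)] by simp

lemma l2inner_uminus_right: "l2inner u (\<lambda>x. - v x) = - l2inner u v"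
  unfolding l2inner_eq hinner_minus_right by (simp add: infsum_uminus)

lemma l2inner_self:
  assumes "u \<in> l2"
  shows "l2inner u u = of_real ((l2norm u)\<^sup>2)"
proof -
  have s: "(\<lambda>x. (norm (u x))\<^sup>2) summable_on UNIV" using assms unfolding l2_def by simp
  have "l2inner u u = of_real (\<Sum>\<^sub>\<infinity>x. (norm (u x))\<^sup>2)"
    unfolding l2inner_eq hinner_self by (rule infsumI, rule has_sum_of_real, rule has_sum_infsum[OF s])
  then show ?thesis unfolding l2norm_def by (simp add: infsum_nonneg)
qed

lemma l2norm_eq_0:
  assumes "u \<in> l2" "l2norm u = 0"
  shows "u = (\<lambda>x. 0)"
proof
  fix x
  have s: "(\<lambda>x. (norm (u x))\<^sup>2) summable_on UNIV" using assms unfolding l2_def by simp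
  have "(\<Sum>\<^sub>\<infinity>x. (norm (u x))\<^sup>2) = 0" using assms(2) unfolding l2norm_def by simp
  moreover have "(norm (u x))\<^sup>2 \<le> (\<Sum>\<^sub>\<infinity>x. (norm (u x))\<^sup>2)"
    using finite_sum_le_infsum[OF s, of "{x}"] by simp
  ultimately have "(norm (u x))\<^sup>2 \<le> 0" by simp
  then show "u x = 0" by simp
qed

section \<open>Hermitian symbols and symmetric operators\<close>

definition hermitian :: "symbol \<Rightarrow> bool" where
  "hermitian \<kappa> \<longleftrightarrow> (\<forall>i j. star (\<kappa> $ i $ j) = \<kappa> $ j $ i)"

lemma ker_hermitian:
  assumes "hermitian \<kappa>"
  shows "ker \<kappa> y x $ i $ j = cnj (ker \<kappa> x y $ j $ i)"
proof -
  have "cf (\<kappa> $ i $ j) (y - x) = cf (star (\<kappa> $ j $ i)) (y - x)"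
    using assms unfolding hermitian_def by simp
  then show ?thesis by (simp add: ker_def cf_star)
qed

lemma selfadjoint_ker: "hermitian \<kappa> \<Longrightarrow> selfadjoint_kernel (ker \<kappa>)"
  unfolding selfadjoint_kernel_def by (simp add: vec_eq_iff) (intro allI, rule ker_hermitian)

lemma hinner_ker:
  assumes "hermitian \<kappa>"
  shows "hinner (ker \<kappa> x y *v a) b = hinner a (ker \<kappa> y x *v b)"
proof -
  have "hinner (ker \<kappa> x y *v a) b = (\<Sum>i\<in>UNIV. \<Sum>j\<in>UNIV. cnj (ker \<kappa> x y $ i $ j) * cnj (a $ j) * b $ i)"
    by (simp add: hinner_def matrix_vector_mult_def sum_distrib_right)
  also have "\<dots> = (\<Sum>j\<in>UNIV. \<Sum>i\<in>UNIV. cnj (ker \<kappa> x y $ i $ j) * cnj (a $ j) * b $ i)"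
    by (rule sum.swap)
  also have "\<dots> = hinner a (ker \<kappa> y x *v b)"
    by (simp add: hinner_def matrix_vector_mult_def sum_distrib_left ker_hermitian[OF assms, of y x] mult_ac)
  finally show ?thesis .
qed

lemma dom_minus:
  assumes "hermitian \<kappa>"
  shows "dom \<kappa> (- z) = dom \<kappa> z"
proof -
  have "norm (cf (\<kappa> $ i $ j) (- z)) = norm (cf (\<kappa> $ j $ i) z)" for i j
    using assms cf_star[of "\<kappa> $ i $ j" z] unfolding hermitian_def by simp
  then show ?thesis unfolding dom_def by simp (rule sum.swap)
qed

text \<open>Symmetry is Fubini together with \<open>hinner_ker\<close>. The double family is
  dominated by \<open>dom \<kappa> (x - y)\<close> times the sum of the two squared norms, that is,
  by two scalar convolution families.\<close>

lemma l2inner_kapp: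
  assumes h: "hermitian \<kappa>" and u: "u \<in> l2" and v: "v \<in> l2"
  shows "l2inner (kapp (ker \<kappa>) u) v = l2inner u (kapp (ker \<kappa>) v)"
proof -
  have u2: "(\<lambda>x. (norm (u x))\<^sup>2) summable_on UNIV" and v2: "(\<lambda>x. (norm (v x))\<^sup>2) summable_on UNIV"
    using u v unfolding l2_def by auto
  have bu: "wave_bounded u" and bv: "wave_bounded v" using u v by (auto intro: l2_wave_bounded)
  have s1: "(\<lambda>(x,y). (norm (u y))\<^sup>2 * dom \<kappa> (x - y)) summable_on UNIV"
    by (rule summable_on_conv_nonneg[OF u2 _ dom_summable]) auto
  have sym: "dom \<kappa> (y - x) = dom \<kappa> (x - y)" for x y
    using dom_minus[OF h, of "x - y"] by simp
  have "(\<lambda>z. case prod.swap z of (x,y) \<Rightarrow> (norm (v x))\<^sup>2 * dom \<kappa> (y - x)) summable_on (UNIV :: (site \<times> site) set)"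
    using summable_on_conv_nonneg[OF v2 _ dom_summable[of \<kappa>]] by (simp add: case_prod_unfold)
  then have "(\<lambda>(x,y). (norm (v x))\<^sup>2 * dom \<kappa> (y - x)) summable_on UNIV"
    using summable_on_reindex_bij_betw[OF bij_swap, of "\<lambda>(x,y). (norm (v x))\<^sup>2 * dom \<kappa> (y - x)"]
    by simp
  then have s2: "(\<lambda>(x,y). (norm (v x))\<^sup>2 * dom \<kappa> (x - y)) summable_on UNIV"
    by (subst sym)
  have "(\<lambda>(x,y). norm (hinner (ker \<kappa> x y *v u y) (v x))) summable_on UNIV"
  proof (rule summable_on_le)
    show "(\<lambda>z. (case z of (x,y) \<Rightarrow> (norm (u y))\<^sup>2 * dom \<kappa> (x - y))
        + (case z of (x,y) \<Rightarrow> (norm (v x))\<^sup>2 * dom \<kappa> (x - y))) summable_on UNIV"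
      by (rule summable_on_add[OF s1 s2])
    fix z :: "site \<times> site"
    obtain x y where z: "z = (x,y)" by (cases z)
    have "norm (hinner (ker \<kappa> x y *v u y) (v x)) \<le> 2 * (norm (ker \<kappa> x y *v u y) * norm (v x))"
      by (rule norm_hinner_le)
    also have "\<dots> \<le> 2 * ((dom \<kappa> (x - y) * norm (u y)) * norm (v x))"
      by (intro mult_left_mono mult_right_mono norm_ker_mult_le) auto
    also have "\<dots> = dom \<kappa> (x - y) * (2 * norm (u y) * norm (v x))" by simp
    also have "\<dots> \<le> dom \<kappa> (x - y) * ((norm (u y))\<^sup>2 + (norm (v x))\<^sup>2)"
      by (intro mult_left_mono sum_squares_bound) auto
    finally show "(case z of (x,y) \<Rightarrow> norm (hinner (ker \<kappa> x y *v u y) (v x)))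
      \<le> (case z of (x,y) \<Rightarrow> (norm (u y))\<^sup>2 * dom \<kappa> (x - y)) + (case z of (x,y) \<Rightarrow> (norm (v x))\<^sup>2 * dom \<kappa> (x - y))"
      by (simp add: z algebra_simps)
  qed auto
  then have s: "(\<lambda>(x,y). hinner (ker \<kappa> x y *v u y) (v x)) summable_on (UNIV \<times> UNIV)"
    unfolding UNIV_Times_UNIV case_prod_unfold by (rule abs_summable_summable)
  have "l2inner (kapp (ker \<kappa>) u) v = (\<Sum>\<^sub>\<infinity>x. \<Sum>\<^sub>\<infinity>y. hinner (ker \<kappa> x y *v u y) (v x))"
    unfolding l2inner_eq kapp_def
    by (rule infsum_cong, rule infsumI[symmetric], rule has_sum_bounded_linear[OF bounded_linear_hinner_left],
        rule has_sum_infsum, rule ker_summable(2)[OF bu])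
  also have "\<dots> = (\<Sum>\<^sub>\<infinity>y. \<Sum>\<^sub>\<infinity>x. hinner (ker \<kappa> x y *v u y) (v x))"
    by (rule infsum_swap_banach[OF s])
  also have "\<dots> = (\<Sum>\<^sub>\<infinity>y. \<Sum>\<^sub>\<infinity>x. hinner (u y) (ker \<kappa> y x *v v x))"
    by (simp add: hinner_ker[OF h])
  also have "\<dots> = l2inner u (kapp (ker \<kappa>) v)"
    unfolding l2inner_eq kapp_def
    by (rule infsum_cong, rule infsumI, rule has_sum_bounded_linear[OF bounded_linear_hinner_right],
        rule has_sum_infsum, rule ker_summable(2)[OF bv])
  finally show ?thesis .
qed

section \<open>Spectral projections of flat Hamiltonians\<close>

definition projection_symbol :: "symbol \<Rightarrow> bool" where
  "projection_symbol p \<longleftrightarrow> hermitian p \<and> p ** p = p"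

text \<open>Equal to -1 on the range of the projection and to 1 on its complement; written with
  subtractions only, so that \<open>kapp_ker_diff\<close> evaluates it.\<close>

definition flat :: "symbol \<Rightarrow> symbol" where
  "flat p = mat 1 - p - p"

text \<open>The value 0 off l2 matches the convention in \<open>is_spec_proj\<close>, by which the
  definite description in \<open>spec_proj\<close> can denote a single function.\<close>

definition proj :: "symbol \<Rightarrow> wave \<Rightarrow> wave" where
  "proj p u = (if u \<in> l2 then kapp (ker p) u else (\<lambda>x. 0))"

lemma proj_l2: "proj p u \<in> l2"
  unfolding proj_def by (simp add: kapp_ker_l2 l2_zero)

lemma kapp_flat:
  assumes "u \<in> l2"
  shows "kapp (ker (flat p)) u = (\<lambda>x. u x - kapp (ker p) u x - kapp (ker p) u x)"
  unfolding flat_def kapp_ker_diff[OF l2_wave_bounded[OF assms]] kapp_ker_mat_1 ..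

lemma proj_idem:
  assumes "projection_symbol p" "u \<in> l2"
  shows "kapp (ker p) (kapp (ker p) u) = kapp (ker p) u"
  using assms by (simp add: kapp_compose l2_wave_bounded projection_symbol_def)

lemma kapp_flat_range:
  assumes "projection_symbol p" "u \<in> l2"
  shows "kapp (ker (flat p)) (kapp (ker p) u) = (\<lambda>x. - kapp (ker p) u x)"
  using assms by (simp add: kapp_flat kapp_ker_l2 proj_idem)

lemma kapp_diff_l2:
  "u \<in> l2 \<Longrightarrow> v \<in> l2 \<Longrightarrow> kapp (ker \<kappa>) (\<lambda>x. u x - v x) = (\<lambda>x. kapp (ker \<kappa>) u x - kapp (ker \<kappa>) v x)"
  by (simp add: kapp_diff l2_wave_bounded)

lemma kapp_flat_complement:
  assumes "projection_symbol p" "u \<in> l2"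
  shows "kapp (ker (flat p)) (\<lambda>x. u x - kapp (ker p) u x) = (\<lambda>x. u x - kapp (ker p) u x)"
  using assms by (simp add: kapp_diff_l2 kapp_ker_l2 kapp_flat proj_idem)

lemma proj_flat:
  assumes p: "projection_symbol p" and u: "u \<in> l2"
  shows "kapp (ker p) (kapp (ker (flat p)) u) = (\<lambda>x. - kapp (ker p) u x)"
proof -
  have pu: "kapp (ker p) u \<in> l2" using u by (rule kapp_ker_l2)
  show ?thesis
    unfolding kapp_flat[OF u] kapp_diff_l2[OF l2_diff[OF u pu] pu] kapp_diff_l2[OF u pu] proj_idem[OF p u]
    by simp
qed

lemma kapp_flat_flat:
  assumes p: "projection_symbol p" and u: "u \<in> l2"
  shows "kapp (ker (flat p)) (kapp (ker (flat p)) u) = u"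
  unfolding kapp_flat[OF kapp_ker_l2(1)[OF u]] proj_flat[OF p u] by (simp add: kapp_flat[OF u])

lemma star_zero: "star 0 = 0"
  by (rule expseq_eqI) (simp add: cf_star)

lemma hermitian_flat: "hermitian p \<Longrightarrow> hermitian (flat p)"
  unfolding hermitian_def flat_def vector_minus_component star_minus
  by (simp add: mat_def star_one star_zero)

text \<open>An involution is its own inverse, so the operator itself serves as the resolvent at
  0.\<close>

lemma flat_not_in_spectrum:
  assumes "projection_symbol p"
  shows "0 \<notin> spectrum_k (ker (flat p))"
  unfolding spectrum_k_def in_resolvent_def mem_Collect_eq not_not
proof (intro exI[of _ "kapp (ker (flat p))"] conjI)
  show "\<exists>C. \<forall>u\<in>l2. kapp (ker (flat p)) u \<in> l2 \<and> l2norm (kapp (ker (flat p)) u) \<le> C * l2norm u"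
    using kapp_ker_l2 by blast
qed (use assms kapp_flat_flat in auto)

lemma is_spec_proj_flat:
  assumes p: "projection_symbol p"
  shows "is_spec_proj (ker (flat p)) 0 (proj p)"
  unfolding is_spec_proj_def
proof (intro conjI allI ballI impI)
  fix u v assume uv: "u \<in> l2" "v \<in> l2"
  show "l2inner (proj p u) v = l2inner u (proj p v)"
    using uv p l2inner_kapp by (simp add: proj_def projection_symbol_def)
next
  fix u assume u: "u \<in> l2"
  have pu: "proj p u = kapp (ker p) u" "kapp (ker p) u \<in> l2" using u by (auto simp: proj_def kapp_ker_l2)
  show "proj p u \<in> l2" by (rule proj_l2)
  show "proj p (proj p u) = proj p u" using u p by (simp add: proj_def kapp_ker_l2 proj_idem)
  show "proj p (kapp (ker (flat p)) u) = kapp (ker (flat p)) (proj p u)"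
    using u p by (simp add: proj_def kapp_ker_l2 kapp_flat_range proj_flat)
  show "Re (l2inner (proj p u) (kapp (ker (flat p)) (proj p u))) \<le> 0 * (l2norm (proj p u))\<^sup>2"
    unfolding pu kapp_flat_range[OF p u] l2inner_uminus_right l2inner_self[OF pu(2)] by simp
  show "0 * (l2norm (\<lambda>x. u x - proj p u x))\<^sup>2
      \<le> Re (l2inner (\<lambda>x. u x - proj p u x) (kapp (ker (flat p)) (\<lambda>x. u x - proj p u x)))"
    unfolding pu kapp_flat_complement[OF p u] l2inner_self[OF l2_diff[OF u pu(2)]] by simp
qed (auto simp: proj_def)

text \<open>Linearity is not among the clauses of \<open>is_spec_proj\<close>; additivity comes from
  symmetry, since moving \<open>Q\<close> to the other side of the inner product shows that the
  defect \<open>d\<close> is orthogonal to itself.\<close>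

lemma symmetric_additive:
  assumes Q: "\<And>u. u \<in> l2 \<Longrightarrow> Q u \<in> l2" "\<And>u v. u \<in> l2 \<Longrightarrow> v \<in> l2 \<Longrightarrow> l2inner (Q u) v = l2inner u (Q v)"
    and u: "u \<in> l2" and v: "v \<in> l2"
  shows "Q (\<lambda>x. u x + v x) = (\<lambda>x. Q u x + Q v x)"
proof -
  define d where "d = (\<lambda>x. Q (\<lambda>x. u x + v x) x - (Q u x + Q v x))"
  have l: "Q u \<in> l2" "Q v \<in> l2" "(\<lambda>x. u x + v x) \<in> l2" "Q (\<lambda>x. u x + v x) \<in> l2" "(\<lambda>x. Q u x + Q v x) \<in> l2"
    using Q(1) u v l2_add by auto
  then have d: "d \<in> l2" unfolding d_def by (intro l2_diff)
  have "l2inner d d = l2inner (Q (\<lambda>x. u x + v x)) d - (l2inner (Q u) d + l2inner (Q v) d)"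
    using l d l2inner_diff_left[OF l(4,5) d] l2inner_add_left[OF l(1,2) d] by (simp add: d_def[symmetric])
  also have "\<dots> = 0"
    using Q(2)[OF l(3) d] Q(2)[OF u d] Q(2)[OF v d] l2inner_add_left[OF u v Q(1)[OF d]] by simp
  finally have "d = (\<lambda>x. 0)" using l2inner_self[OF d] l2norm_eq_0[OF d] by simp
  then show ?thesis unfolding d_def by (metis (no_types, lifting) ext right_minus_eq)
qed

text \<open>A wave in l2 splits into \<open>a\<close> and \<open>b\<close> with eigenvalues -1 and
  1. Commutation keeps \<open>Q b\<close> in the second eigenspace and \<open>a - Q a\<close> in the
  first, where the two form inequalities at level 0 have the wrong sign and force both to
  vanish.\<close>

lemma spec_proj_flat_unique:
  assumes p: "projection_symbol p" and Q: "is_spec_proj (ker (flat p)) 0 Q"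
  shows "Q = proj p"
proof
  fix u
  let ?K = "kapp (ker (flat p))"
  have Ql2: "\<And>u. u \<in> l2 \<Longrightarrow> Q u \<in> l2"
    and Qsym: "\<And>u v. u \<in> l2 \<Longrightarrow> v \<in> l2 \<Longrightarrow> l2inner (Q u) v = l2inner u (Q v)"
    and QK: "\<And>u. u \<in> l2 \<Longrightarrow> Q (?K u) = ?K (Q u)"
    and Qle: "\<And>u. u \<in> l2 \<Longrightarrow> Re (l2inner (Q u) (?K (Q u))) \<le> 0"
    and Qge: "\<And>u. u \<in> l2 \<Longrightarrow> Re (l2inner (\<lambda>x. u x - Q u x) (?K (\<lambda>x. u x - Q u x))) \<ge> 0"
    using Q unfolding is_spec_proj_def by auto
  have Qadd: "Q (\<lambda>x. u x + v x) = (\<lambda>x. Q u x + Q v x)" if "u \<in> l2" "v \<in> l2" for u v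
    using symmetric_additive[of Q, OF Ql2 Qsym that] .
  show "Q u = proj p u"
  proof (cases "u \<in> l2")
    case False
    then show ?thesis using Q unfolding is_spec_proj_def by (simp add: proj_def)
  next
    case u: True
    define a where "a = kapp (ker p) u"
    define b where "b = (\<lambda>x. u x - a x)"
    have a: "a \<in> l2" "?K a = (\<lambda>x. - a x)" unfolding a_def using u p by (auto simp: kapp_ker_l2 kapp_flat_range)
    have b: "b \<in> l2" "?K b = b" unfolding b_def using a(1) u l2_diff kapp_flat_complement[OF p u] by (auto simp: a_def)
    have Qb: "Q b = (\<lambda>x. 0)"
    proof -
      have "?K (Q b) = Q b" using QK[OF b(1)] b(2) by simp
      then have "(l2norm (Q b))\<^sup>2 \<le> 0" using Qle[OF b(1)] l2inner_self[OF Ql2[OF b(1)]] by simp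
      then show ?thesis using l2norm_eq_0[OF Ql2[OF b(1)]] by simp
    qed
    \<comment> \<open>The argument for \<open>a\<close> needs \<open>Q\<close> to be odd, an
      instance of homogeneity that additivity provides.\<close>
    have Q0: "Q (\<lambda>x. 0) = (\<lambda>x. 0)" using Qadd[OF l2_zero l2_zero] by (simp add: fun_eq_iff)
    have Qm: "Q (\<lambda>x. - a x) = (\<lambda>x. - Q a x)"
      using Qadd[OF a(1) l2_uminus[OF a(1)]] Q0 by (simp add: fun_eq_iff) (metis add.inverse_unique)
    define d where "d = (\<lambda>x. a x - Q a x)"
    have d: "d \<in> l2" unfolding d_def using a(1) Ql2 l2_diff by blast
    have "?K (Q a) = (\<lambda>x. - Q a x)" using QK[OF a(1)] a(2) Qm by simp
    then have "?K d = (\<lambda>x. - d x)" unfolding d_def using a Ql2[OF a(1)] by (simp add: kapp_diff_l2)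
    then have "(l2norm d)\<^sup>2 \<le> 0"
      using Qge[OF a(1)] unfolding d_def[symmetric] by (simp add: l2inner_uminus_right l2inner_self[OF d])
    then have "d = (\<lambda>x. 0)" using l2norm_eq_0[OF d] by simp
    then have Qa: "Q a = a" unfolding d_def by (simp add: fun_eq_iff)
    have "(\<lambda>x. a x + b x) = u" unfolding b_def by simp
    then have "Q u = a" using Qadd[OF a(1) b(1)] Qa Qb by simp
    then show ?thesis unfolding a_def proj_def using u by simp
  qed
qed

lemma spec_proj_flat:
  assumes "projection_symbol p"
  shows "spec_proj (ker (flat p)) 0 = proj p"
  unfolding spec_proj_def
  by (rule the_equality) (use assms is_spec_proj_flat spec_proj_flat_unique in auto)

section \<open>The trace as a zero mode\<close>

definition chi :: "int \<Rightarrow> complex" where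
  "chi n = (if 0 \<le> n then 1 else 0)"

lemma chi_shift_sum_aux:
  assumes "t \<le> s"
  shows "((\<lambda>n. chi (n + s) - chi (n + t)) has_sum of_int (s - t)) UNIV"
    and "((\<lambda>n. norm (chi (n + s) - chi (n + t))) has_sum of_int \<bar>s - t\<bar>) UNIV"
proof -
  have eq: "chi (n + s) - chi (n + t) = (if n \<in> {-s..<-t} then 1 else 0)" for n
    using assms by (auto simp: chi_def)
  show "((\<lambda>n. chi (n + s) - chi (n + t)) has_sum of_int (s - t)) UNIV"
    unfolding eq by (rule has_sum_finite_neutralI[of "{-s..<-t}"]) (use assms in auto)
  show "((\<lambda>n. norm (chi (n + s) - chi (n + t))) has_sum of_int \<bar>s - t\<bar>) UNIV"
    unfolding eq by (rule has_sum_finite_neutralI[of "{-s..<-t}"]) (use assms in auto)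
qed

text \<open>The difference of two shifted steps is 1 or -1 between the jumps and 0 elsewhere, so its
  sum is a signed count of lattice points. This is how a cut-off becomes a coordinate.\<close>

lemma chi_shift_sum:
  shows "((\<lambda>n. chi (n + s) - chi (n + t)) has_sum of_int (s - t)) UNIV"
    and "((\<lambda>n. norm (chi (n + s) - chi (n + t))) has_sum of_int \<bar>s - t\<bar>) UNIV"
proof -
  have "((\<lambda>n. chi (n + s) - chi (n + t)) has_sum of_int (s - t)) UNIV \<and>
    ((\<lambda>n. norm (chi (n + s) - chi (n + t))) has_sum of_int \<bar>s - t\<bar>) UNIV"
  proof (cases "t \<le> s")
    case False
    then have ts: "s \<le> t" by simp
    have "((\<lambda>n. - (chi (n + t) - chi (n + s))) has_sum - of_int (t - s)) UNIV"
      by (rule has_sum_uminusI[OF chi_shift_sum_aux(1)[OF ts]])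
    then show ?thesis using chi_shift_sum_aux(2)[OF ts] by (simp add: norm_minus_commute abs_minus_commute)
  qed (use chi_shift_sum_aux in auto)
  then show "((\<lambda>n. chi (n + s) - chi (n + t)) has_sum of_int (s - t)) UNIV"
    and "((\<lambda>n. norm (chi (n + s) - chi (n + t))) has_sum of_int \<bar>s - t\<bar>) UNIV" by auto
qed

lemma has_sum_times:
  fixes f :: "'a \<Rightarrow> 'c::{real_normed_field,banach}" and g :: "'b \<Rightarrow> 'c"
  assumes f: "(f has_sum a) UNIV" "(\<lambda>x. norm (f x)) summable_on UNIV"
    and g: "(g has_sum b) UNIV" "(\<lambda>x. norm (g x)) summable_on UNIV"
  shows "((\<lambda>(x,y). f x * g y) has_sum a * b) UNIV"
proof -
  have "(\<lambda>(x,y). norm (f x) * norm (g y)) summable_on (UNIV \<times> UNIV)"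
    by (rule summable_on_times_nonneg) (use f g in auto)
  then have "(\<lambda>(x,y). f x * g y) summable_on (UNIV \<times> UNIV)"
    by (intro abs_summable_summable[of "\<lambda>(x,y). f x * g y"]) (simp add: case_prod_unfold norm_mult)
  then have "((\<lambda>(x,y). f x * g y) has_sum a * b) (UNIV \<times> UNIV)"
    by (intro has_sum_SigmaI[where g="\<lambda>x. f x * b"])
      (auto intro: has_sum_cmult_right has_sum_cmult_left f g)
  then show ?thesis by simp
qed

text \<open>Both orders of the two directions occur in the commutator; the predicate ties each
  coordinate to its derivation so that one computation covers both.\<close>

definition axes :: "(site \<Rightarrow> int) \<Rightarrow> (site \<Rightarrow> int) \<Rightarrow> (expseq \<Rightarrow> expseq) \<Rightarrow> (expseq \<Rightarrow> expseq) \<Rightarrow> bool" where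
  "axes \<pi> \<pi>' D D' \<longleftrightarrow> \<pi> = fst \<and> \<pi>' = snd \<and> D = D1 \<and> D' = D2 \<or> \<pi> = snd \<and> \<pi>' = fst \<and> D = D2 \<and> D' = D1"

lemma axes_add: "axes \<pi> \<pi>' D D' \<Longrightarrow> \<pi> (x + y) = \<pi> x + \<pi> y" "axes \<pi> \<pi>' D D' \<Longrightarrow> \<pi>' (x + y) = \<pi>' x + \<pi>' y"
  by (auto simp: axes_def)

lemma axes_cf:
  "axes \<pi> \<pi>' D D' \<Longrightarrow> cf (D a) x = of_int (\<pi> x) * cf a x"
  "axes \<pi> \<pi>' D D' \<Longrightarrow> cf (D' a) x = of_int (\<pi>' x) * cf a x"
  by (auto simp: axes_def cf_D1 cf_D2)

lemma axes_has_sum: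
  fixes f g :: "int \<Rightarrow> 'c::{real_normed_field,banach}"
  assumes ax: "axes \<pi> \<pi>' D D'"
    and fg: "(f has_sum a) UNIV" "(\<lambda>x. norm (f x)) summable_on UNIV"
     "(g has_sum b) UNIV" "(\<lambda>x. norm (g x)) summable_on UNIV"
  shows "((\<lambda>x. f (\<pi> x) * g (\<pi>' x)) has_sum a * b) UNIV"
  using ax has_sum_times[OF fg] has_sum_times[OF fg(3,4) fg(1,2)]
  by (auto simp: axes_def case_prod_unfold mult.commute)

text \<open>For fixed differences \<open>y - z\<close> and \<open>z - x\<close>, summing the cut-off factors over all common
  translations replaces each of them by a coordinate difference, that is, by a derivation.\<close>

lemma triple_sum:
  fixes a b c :: expseq
  assumes ax: "axes \<pi> \<pi>' D D'"
  defines "F \<equiv> \<lambda>x y z. cf a (x - y) * ((chi (\<pi> z) - chi (\<pi> y)) * cf b (y - z)) * ((chi (\<pi>' x) - chi (\<pi>' z)) * cf c (z - x))"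
  shows "F x y summable_on UNIV" "(\<lambda>y. infsum (F x y) UNIV) summable_on UNIV"
    "((\<lambda>x. \<Sum>\<^sub>\<infinity>y. infsum (F x y) UNIV) has_sum cf (a * (D b * D' c)) 0) UNIV"
proof -
  \<comment> \<open>In the differences \<open>\<beta> = y - z\<close> and
    \<open>\<gamma> = z - x\<close> the kernels form the translation-invariant factor
    \<open>G\<close>, while \<open>h\<close> keeps the cut-offs as a function of the base point
    \<open>x\<close>.\<close>
  define G where "G \<beta> \<gamma> = cf a (- \<beta> - \<gamma>) * cf b \<beta> * cf c \<gamma>" for \<beta> \<gamma>
  define h where "h \<beta> \<gamma> x = (chi (\<pi> x + \<pi> \<gamma>) - chi (\<pi> x + (\<pi> \<beta> + \<pi> \<gamma>))) * (chi (\<pi>' x + 0) - chi (\<pi>' x + \<pi>' \<gamma>))" for \<beta> \<gamma> x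
  have h1: "(h \<beta> \<gamma> has_sum of_int (\<pi> \<beta>) * of_int (\<pi>' \<gamma>)) UNIV" for \<beta> \<gamma>
  proof -
    \<comment> \<open>The factors are \<open>- \<pi> \<beta>\<close> and
      \<open>- \<pi>' \<gamma>\<close>, and the two signs cancel.\<close>
    have "(h \<beta> \<gamma> has_sum of_int (\<pi> \<gamma> - (\<pi> \<beta> + \<pi> \<gamma>)) * of_int (0 - \<pi>' \<gamma>)) UNIV"
      unfolding h_def[abs_def]
      by (rule axes_has_sum[OF ax]) (use chi_shift_sum has_sum_imp_summable in blast)+
    then show ?thesis by simp
  qed
  have h2: "((\<lambda>x. norm (h \<beta> \<gamma> x)) has_sum of_int \<bar>\<pi> \<beta>\<bar> * of_int \<bar>\<pi>' \<gamma>\<bar>) UNIV" for \<beta> \<gamma>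
  proof -
    have "((\<lambda>x. norm (h \<beta> \<gamma> x)) has_sum of_int \<bar>\<pi> \<gamma> - (\<pi> \<beta> + \<pi> \<gamma>)\<bar> * of_int \<bar>0 - \<pi>' \<gamma>\<bar>) UNIV"
      unfolding h_def[abs_def] norm_mult
      by (rule axes_has_sum[OF ax chi_shift_sum(2) _ chi_shift_sum(2)])
        (simp_all only: real_norm_def abs_norm_cancel has_sum_imp_summable[OF chi_shift_sum(2)])
    then show ?thesis by simp
  qed
  \<comment> \<open>A uniform bound on \<open>a\<close> is enough: the coordinate weights are
    absorbed by \<open>D b\<close> and \<open>D' c\<close>, which are summable.\<close>
  obtain M where M: "\<And>x. norm (cf a x) \<le> M" using norm_le_infsum_norm[OF cf_summable] by blast
  have Gs: "(\<lambda>(\<beta>,\<gamma>). norm (G \<beta> \<gamma>) * (of_int \<bar>\<pi> \<beta>\<bar> * of_int \<bar>\<pi>' \<gamma>\<bar>)) summable_on UNIV"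
  proof (rule summable_on_le)
    have "(\<lambda>(\<beta>,\<gamma>). norm (cf (D b) \<beta>) * norm (cf (D' c) \<gamma>)) summable_on (UNIV \<times> UNIV)"
      by (intro summable_on_times_nonneg cf_summable) auto
    from summable_on_cmult_right[OF this, of M]
    show "(\<lambda>(\<beta>,\<gamma>). M * (norm (cf (D b) \<beta>) * norm (cf (D' c) \<gamma>))) summable_on UNIV"
      by (simp add: case_prod_unfold)
    fix z :: "site \<times> site"
    obtain \<beta> \<gamma> where z: "z = (\<beta>, \<gamma>)" by (cases z)
    show "(case z of (\<beta>,\<gamma>) \<Rightarrow> norm (G \<beta> \<gamma>) * (of_int \<bar>\<pi> \<beta>\<bar> * of_int \<bar>\<pi>' \<gamma>\<bar>))
       \<le> (case z of (\<beta>,\<gamma>) \<Rightarrow> M * (norm (cf (D b) \<beta>) * norm (cf (D' c) \<gamma>)))"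
      using mult_right_mono[OF M[of "- \<beta> - \<gamma>"], of "norm (cf (D b) \<beta>) * norm (cf (D' c) \<gamma>)"]
      by (simp add: z G_def axes_cf[OF ax] norm_mult mult_ac)
  qed auto
  have "(\<lambda>(bg,x). norm (case bg of (\<beta>,\<gamma>) \<Rightarrow> G \<beta> \<gamma> * h \<beta> \<gamma> x)) summable_on (UNIV \<times> UNIV)"
  proof (rule summable_on_SigmaI[OF _ Gs])
    fix bg :: "site \<times> site"
    obtain \<beta> \<gamma> where bg: "bg = (\<beta>, \<gamma>)" by (cases bg)
    show "((\<lambda>x. case (bg, x) of (bg, x) \<Rightarrow> norm (case bg of (\<beta>,\<gamma>) \<Rightarrow> G \<beta> \<gamma> * h \<beta> \<gamma> x))
        has_sum (case bg of (\<beta>,\<gamma>) \<Rightarrow> norm (G \<beta> \<gamma>) * (of_int \<bar>\<pi> \<beta>\<bar> * of_int \<bar>\<pi>' \<gamma>\<bar>))) UNIV"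
      unfolding bg prod.case norm_mult by (rule has_sum_cmult_right[OF h2])
  qed auto
  then have s: "(\<lambda>(bg,x). case bg of (\<beta>,\<gamma>) \<Rightarrow> G \<beta> \<gamma> * h \<beta> \<gamma> x) summable_on (UNIV \<times> UNIV)"
    by (intro abs_summable_summable[of "\<lambda>(bg,x). case bg of (\<beta>,\<gamma>) \<Rightarrow> G \<beta> \<gamma> * h \<beta> \<gamma> x"]) (simp add: case_prod_unfold)
  have "(\<Sum>\<^sub>\<infinity>(bg,x). case bg of (\<beta>,\<gamma>) \<Rightarrow> G \<beta> \<gamma> * h \<beta> \<gamma> x)
      = (\<Sum>\<^sub>\<infinity>bg. \<Sum>\<^sub>\<infinity>x. case bg of (\<beta>,\<gamma>) \<Rightarrow> G \<beta> \<gamma> * h \<beta> \<gamma> x)"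
    using infsum_Sigma'_banach[OF s] by simp
  also have "\<dots> = (\<Sum>\<^sub>\<infinity>(\<beta>,\<gamma>). cf (D b) \<beta> * (cf (D' c) \<gamma> * cf a (0 - \<beta> - \<gamma>)))"
  proof (rule infsum_cong)
    fix bg :: "site \<times> site"
    obtain \<beta> \<gamma> where bg: "bg = (\<beta>, \<gamma>)" by (cases bg)
    show "(\<Sum>\<^sub>\<infinity>x. case bg of (\<beta>,\<gamma>) \<Rightarrow> G \<beta> \<gamma> * h \<beta> \<gamma> x)
        = (case bg of (\<beta>,\<gamma>) \<Rightarrow> cf (D b) \<beta> * (cf (D' c) \<gamma> * cf a (0 - \<beta> - \<gamma>)))"
      unfolding bg prod.case infsumI[OF has_sum_cmult_right[OF h1]] by (simp add: G_def axes_cf[OF ax] mult_ac)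
  qed
  also have "\<dots> = (\<Sum>\<^sub>\<infinity>\<beta>. \<Sum>\<^sub>\<infinity>\<gamma>. cf (D b) \<beta> * (cf (D' c) \<gamma> * cf a (0 - \<beta> - \<gamma>)))"
  proof -
    have "(\<lambda>(\<beta>,\<gamma>). norm (cf (D b) \<beta> * (cf (D' c) \<gamma> * cf a (0 - \<beta> - \<gamma>)))) summable_on UNIV"
      using Gs by (rule summable_on_cong[THEN iffD1, rotated])
        (auto simp: G_def axes_cf[OF ax] norm_mult mult_ac)
    then have "(\<lambda>(\<beta>,\<gamma>). cf (D b) \<beta> * (cf (D' c) \<gamma> * cf a (0 - \<beta> - \<gamma>))) summable_on (UNIV \<times> UNIV)"
      unfolding UNIV_Times_UNIV case_prod_unfold by (rule abs_summable_summable)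
    from infsum_Sigma'_banach[OF this] show ?thesis by simp
  qed
  also have "\<dots> = cf (D b * (D' c * a)) 0"
    unfolding cf_times by (simp add: infsum_cmult_right')
  finally have val: "(\<Sum>\<^sub>\<infinity>(bg,x). case bg of (\<beta>,\<gamma>) \<Rightarrow> G \<beta> \<gamma> * h \<beta> \<gamma> x) = cf (a * (D b * D' c)) 0"
    by (simp add: mult_ac)
  \<comment> \<open>Back to sites by a bijection of triples; absolute summability transfers and
    yields the iterated sums in the order of the claim.\<close>
  let ?t = "\<lambda>(x,(y,z)). ((y - z, z - x), x)"
  have bij: "bij_betw ?t UNIV (UNIV :: ((site \<times> site) \<times> site) set)"
    by (rule bij_betwI[where g="\<lambda>((\<beta>,\<gamma>),x). (x, (x + \<gamma> + \<beta>, x + \<gamma>))"]) auto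
  have eq: "(case ?t w of (bg,x) \<Rightarrow> case bg of (\<beta>,\<gamma>) \<Rightarrow> G \<beta> \<gamma> * h \<beta> \<gamma> x) = (case w of (x,(y,z)) \<Rightarrow> F x y z)" for w
  proof -
    obtain x y z where w: "w = (x,(y,z))" by (cases w) auto
    have "\<pi> z = \<pi> x + \<pi> (z - x)" "\<pi>' z = \<pi>' x + \<pi>' (z - x)" "\<pi> y = \<pi> x + (\<pi> (y - z) + \<pi> (z - x))"
      unfolding axes_add[OF ax, symmetric] by (auto simp: algebra_simps)
    moreover have "- (y - z) - (z - x) = x - y" by simp
    ultimately show ?thesis unfolding w F_def G_def h_def by (simp add: mult_ac)
  qed
  have sF: "(\<lambda>(x,(y,z)). F x y z) summable_on (UNIV \<times> UNIV)"
    using s summable_on_reindex_bij_betw[OF bij, of "\<lambda>(bg,x). case bg of (\<beta>,\<gamma>) \<Rightarrow> G \<beta> \<gamma> * h \<beta> \<gamma> x"]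
    unfolding eq by simp
  have vF: "(\<Sum>\<^sub>\<infinity>(x,(y,z)). F x y z) = cf (a * (D b * D' c)) 0"
    using val infsum_reindex_bij_betw[OF bij, of "\<lambda>(bg,x). case bg of (\<beta>,\<gamma>) \<Rightarrow> G \<beta> \<gamma> * h \<beta> \<gamma> x"]
    unfolding eq by simp
  have sx: "(\<lambda>(y,z). F x y z) summable_on (UNIV \<times> UNIV)" for x
    using summable_on_SigmaD1[OF sF, of x] by simp
  show "F x y summable_on UNIV" using summable_on_SigmaD1[OF sx, of y x] by simp
  show "(\<lambda>y. infsum (F x y) UNIV) summable_on UNIV"
    using summable_on_Sigma_banach[OF sx[of x]] by simp
  have in_eq: "(\<Sum>\<^sub>\<infinity>(y,z). F x y z) = (\<Sum>\<^sub>\<infinity>y. infsum (F x y) UNIV)" for x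
    using infsum_Sigma'_banach[OF sx[of x]] by simp
  show "((\<lambda>x. \<Sum>\<^sub>\<infinity>y. infsum (F x y) UNIV) has_sum cf (a * (D b * D' c)) 0) UNIV"
    unfolding has_sum_iff
    using summable_on_Sigma_banach[OF sF] infsum_Sigma'_banach[OF sF] vF in_eq by simp
qed

section \<open>Commutators with half-plane cut-offs\<close>

definition lam :: "(site \<Rightarrow> int) \<Rightarrow> wave \<Rightarrow> wave" where
  "lam \<pi> u = (\<lambda>x. if \<pi> x \<ge> 0 then u x else 0)"

lemma lam_l2:
  assumes "u \<in> l2"
  shows "lam \<pi> u \<in> l2"
  using assms unfolding l2_def mem_Collect_eq lam_def by (rule summable_on_le) auto

lemma kapp_ker_component:
  assumes "u \<in> l2"
  shows "((\<lambda>y. \<Sum>l\<in>UNIV. cf (\<kappa> $ k $ l) (x - y) * u y $ l) has_sum kapp (ker \<kappa>) u x $ k) UNIV"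
  using has_sum_bounded_linear[OF bounded_linear_vec_nth[of k] has_sum_infsum[OF ker_summable(2)[OF l2_wave_bounded[OF assms], of \<kappa> x]]]
  unfolding kapp_def by (simp add: ker_def matrix_vector_mult_def)

lemma comm_proj_l2:
  assumes "u \<in> l2"
  shows "comm (proj p) (lam \<pi>) u \<in> l2"
  unfolding comm_def using assms by (intro l2_diff proj_l2 lam_l2)

text \<open>A commutator with a cut-off multiplies the kernel by a difference of steps, so only
  pairs of sites on opposite sides of the axis contribute. This localisation makes the trace
  converge.\<close>

lemma comm_proj_component:
  assumes "u \<in> l2"
  shows "((\<lambda>y. \<Sum>l\<in>UNIV. (chi (\<pi> y) - chi (\<pi> x)) * cf (p $ k $ l) (x - y) * u y $ l)
    has_sum comm (proj p) (lam \<pi>) u x $ k) UNIV"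
proof -
  have "((\<lambda>y. (\<Sum>l\<in>UNIV. cf (p $ k $ l) (x - y) * lam \<pi> u y $ l)
        + - (chi (\<pi> x) * (\<Sum>l\<in>UNIV. cf (p $ k $ l) (x - y) * u y $ l)))
      has_sum (kapp (ker p) (lam \<pi> u) x $ k + - (chi (\<pi> x) * kapp (ker p) u x $ k))) UNIV"
    by (intro has_sum_add has_sum_uminusI has_sum_cmult_right kapp_ker_component assms lam_l2)
  also have "kapp (ker p) (lam \<pi> u) x $ k + - (chi (\<pi> x) * kapp (ker p) u x $ k) = comm (proj p) (lam \<pi>) u x $ k"
    using assms by (simp add: comm_def proj_def lam_l2) (simp add: lam_def chi_def)
  also have "(\<lambda>y. (\<Sum>l\<in>UNIV. cf (p $ k $ l) (x - y) * lam \<pi> u y $ l)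
        + - (chi (\<pi> x) * (\<Sum>l\<in>UNIV. cf (p $ k $ l) (x - y) * u y $ l)))
      = (\<lambda>y. \<Sum>l\<in>UNIV. (chi (\<pi> y) - chi (\<pi> x)) * cf (p $ k $ l) (x - y) * u y $ l)"
    by (auto simp: lam_def chi_def sum_negf)
  finally show ?thesis .
qed

lemma delta_l2: "delta x i \<in> l2"
  unfolding l2_def mem_Collect_eq
  by (rule finite_nonzero_values_imp_summable_on, rule finite_subset[of _ "{x}"]) (auto simp: delta_def)

lemma comm_proj_delta:
  "comm (proj p) (lam \<pi>) (delta x i) z $ l = (chi (\<pi> x) - chi (\<pi> z)) * cf (p $ l $ i) (z - x)"
proof -
  have "((\<lambda>y. \<Sum>m\<in>UNIV. (chi (\<pi> y) - chi (\<pi> z)) * cf (p $ l $ m) (z - y) * delta x i y $ m)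
    has_sum (chi (\<pi> x) - chi (\<pi> z)) * cf (p $ l $ i) (z - x)) UNIV"
    by (rule has_sum_finite_neutralI[of "{x}"]) (auto simp: delta_def axis_def if_distrib cong: if_cong)
  then show ?thesis using has_sum_unique[OF comm_proj_component[OF delta_l2]] by blast
qed

lemma kapp_comm_comm_delta:
  assumes ax: "axes \<pi> \<pi>' D D'"
  shows "kapp (ker p) (comm (proj p) (lam \<pi>) (comm (proj p) (lam \<pi>') (delta x i))) x $ i
    = (\<Sum>k\<in>UNIV. \<Sum>l\<in>UNIV. \<Sum>\<^sub>\<infinity>y. \<Sum>\<^sub>\<infinity>z. cf (p $ i $ k) (x - y) * ((chi (\<pi> z) - chi (\<pi> y)) * cf (p $ k $ l) (y - z))
        * ((chi (\<pi>' x) - chi (\<pi>' z)) * cf (p $ l $ i) (z - x)))"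
    (is "?L = (\<Sum>k\<in>UNIV. \<Sum>l\<in>UNIV. \<Sum>\<^sub>\<infinity>y. \<Sum>\<^sub>\<infinity>z. ?F k l y z)")
proof -
  note ts = triple_sum[OF ax]
  let ?V = "comm (proj p) (lam \<pi>') (delta x i)"
  let ?W = "comm (proj p) (lam \<pi>) ?V"
  have V: "?V \<in> l2" and W: "?W \<in> l2" by (intro comm_proj_l2 delta_l2)+
  have inner: "cf (p $ i $ k) (x - y) * ?W y $ k = (\<Sum>l\<in>UNIV. \<Sum>\<^sub>\<infinity>z. ?F k l y z)" for k y
  proof -
    have "((\<lambda>z. cf (p $ i $ k) (x - y) * (\<Sum>l\<in>UNIV. (chi (\<pi> z) - chi (\<pi> y)) * cf (p $ k $ l) (y - z) * ?V z $ l))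
        has_sum cf (p $ i $ k) (x - y) * ?W y $ k) UNIV"
      by (intro has_sum_cmult_right comm_proj_component V)
    then have "((\<lambda>z. \<Sum>l\<in>UNIV. ?F k l y z) has_sum cf (p $ i $ k) (x - y) * ?W y $ k) UNIV"
      by (simp add: comm_proj_delta sum_distrib_left mult.assoc)
    moreover have "((\<lambda>z. \<Sum>l\<in>UNIV. ?F k l y z) has_sum (\<Sum>l\<in>UNIV. \<Sum>\<^sub>\<infinity>z. ?F k l y z)) UNIV"
      by (intro has_sum_sum has_sum_infsum ts(1)) auto
    ultimately show ?thesis by (rule has_sum_unique)
  qed
  have "((\<lambda>y. \<Sum>k\<in>UNIV. \<Sum>l\<in>UNIV. \<Sum>\<^sub>\<infinity>z. ?F k l y z) has_sum ?L) UNIV"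
    using kapp_ker_component[OF W, of p i x] unfolding inner .
  moreover have "((\<lambda>y. \<Sum>k\<in>UNIV. \<Sum>l\<in>UNIV. \<Sum>\<^sub>\<infinity>z. ?F k l y z)
      has_sum (\<Sum>k\<in>UNIV. \<Sum>l\<in>UNIV. \<Sum>\<^sub>\<infinity>y. \<Sum>\<^sub>\<infinity>z. ?F k l y z)) UNIV"
    by (intro has_sum_sum has_sum_infsum ts(2)) auto
  ultimately show ?thesis by (rule has_sum_unique)
qed

text \<open>The Berry curvature up to a constant factor, as the trace of
  \<open>P [D1 P, D2 P]\<close>; its zero mode is the mean over the torus, hence proportional to the
  Chern number.\<close>

definition chern :: "symbol \<Rightarrow> expseq" where
  "chern p = (\<Sum>i\<in>UNIV. \<Sum>k\<in>UNIV. \<Sum>l\<in>UNIV. p $ i $ k * (D1 (p $ k $ l) * D2 (p $ l $ i) - D2 (p $ k $ l) * D1 (p $ l $ i)))"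

text \<open>The commutators are not translation invariant, but in each summand the kernels see only
  differences of sites, and the base-point sum of the cut-offs is \<open>triple_sum\<close>, applied
  once for each order of the two directions.\<close>

lemma Tr_proj:
  "Tr (\<lambda>u. proj p (comm (comm (proj p) Lam1) (comm (proj p) Lam2) u)) = cf (chern p) 0"
proof -
  have lam: "Lam1 = lam fst" "Lam2 = lam snd" by (auto simp: Lam1_def Lam2_def lam_def)
  have ax: "axes fst snd D1 D2" "axes snd fst D2 D1" by (auto simp: axes_def)
  let ?A = "comm (proj p) (lam fst)" and ?B = "comm (proj p) (lam snd)"
  let ?S = "\<lambda>\<pi> \<pi>' x i k l. \<Sum>\<^sub>\<infinity>y. \<Sum>\<^sub>\<infinity>z. cf (p $ i $ k) (x - y) * ((chi (\<pi> z) - chi (\<pi> y)) * cf (p $ k $ l) (y - z))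
        * ((chi (\<pi>' x) - chi (\<pi>' z)) * cf (p $ l $ i) (z - x))"
  have t: "proj p (comm ?A ?B (delta x i)) x $ i
      = (\<Sum>k\<in>UNIV. \<Sum>l\<in>UNIV. ?S fst snd x i k l + - ?S snd fst x i k l)" for x i
  proof -
    have AB: "?A (?B (delta x i)) \<in> l2" "?B (?A (delta x i)) \<in> l2" by (intro comm_proj_l2 delta_l2)+
    have "comm ?A ?B (delta x i) = (\<lambda>y. ?A (?B (delta x i)) y - ?B (?A (delta x i)) y)"
      by (simp add: comm_def)
    then have "proj p (comm ?A ?B (delta x i)) x $ i
      = kapp (ker p) (?A (?B (delta x i))) x $ i - kapp (ker p) (?B (?A (delta x i))) x $ i"
      using l2_diff[OF AB] by (simp add: proj_def kapp_diff_l2[OF AB])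
    then show ?thesis
      unfolding kapp_comm_comm_delta[OF ax(1)] kapp_comm_comm_delta[OF ax(2)]
      by (simp add: sum_subtractf)
  qed
  have "((\<lambda>x. \<Sum>i\<in>UNIV. \<Sum>k\<in>UNIV. \<Sum>l\<in>UNIV. ?S fst snd x i k l + - ?S snd fst x i k l) has_sum
     (\<Sum>i\<in>UNIV. \<Sum>k\<in>UNIV. \<Sum>l\<in>UNIV. cf (p $ i $ k * (D1 (p $ k $ l) * D2 (p $ l $ i))) 0
       + - cf (p $ i $ k * (D2 (p $ k $ l) * D1 (p $ l $ i))) 0)) UNIV"
    by (intro has_sum_sum has_sum_add has_sum_uminusI triple_sum(3)[OF ax(1)] triple_sum(3)[OF ax(2)]) auto
  then have "Tr (\<lambda>u. proj p (comm ?A ?B u)) =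
     (\<Sum>i\<in>UNIV. \<Sum>k\<in>UNIV. \<Sum>l\<in>UNIV. cf (p $ i $ k * (D1 (p $ k $ l) * D2 (p $ l $ i))) 0
       + - cf (p $ i $ k * (D2 (p $ k $ l) * D1 (p $ l $ i))) 0)"
    unfolding Tr_def t by (rule infsumI)
  then show ?thesis by (simp add: lam chern_def cf_sum right_diff_distrib)
qed

lemma sigma_flat:
  assumes "projection_symbol p"
  shows "sigma (ker (flat p)) 0 = - 2 * of_real pi * \<i> * cf (chern p) 0"
  unfolding sigma_def Let_def spec_proj_flat[OF assms] Tr_proj ..

text \<open>Shrinking \<nu> enlarges the prefactor and lowers the rate, so exponential decay at any
  rate becomes the required bound for every small \<nu>. Covering all smaller values allows one
  \<nu> to serve several operators.\<close>

lemma short_range_flat: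
  assumes "hermitian p"
  obtains \<nu>0 where "0 < \<nu>0" "\<And>\<nu>. 0 < \<nu> \<Longrightarrow> \<nu> \<le> \<nu>0 \<Longrightarrow> short_range \<nu> (ker p)"
proof -
  \<comment> \<open>The matrix norm is bounded by the sum over four entries, hence the 4 in the
    entrywise bound.\<close>
  have "\<exists>\<nu>0>0. \<forall>\<nu>. 0 < \<nu> \<and> \<nu> \<le> \<nu>0 \<longrightarrow> (\<forall>z. norm (cf a z) \<le> (1 / (4 * \<nu>)) * exp (- 2 * \<nu> * real (sz z)))" for a
  proof -
    obtain \<rho> where \<rho>: "1 < \<rho>" "wsum \<rho> (cf a)" by (rule cf_wsum)
    define C where "C = max 1 (wnorm \<rho> (cf a))"
    \<comment> \<open>\<open>1 / (4 * C)\<close> lets the prefactor dominate the weighted norm, and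
      \<open>ln \<rho> / 2\<close> keeps \<open>exp (2 * \<nu>)\<close> below the weight
      \<open>\<rho>\<close>.\<close>
    define \<nu>0 where "\<nu>0 = min (1 / (4 * C)) (ln \<rho> / 2)"
    have C: "1 \<le> C" "wnorm \<rho> (cf a) \<le> C" unfolding C_def by auto
    have "0 < \<nu>0" unfolding \<nu>0_def using \<rho> C by auto
    moreover have "norm (cf a z) \<le> (1 / (4 * \<nu>)) * exp (- 2 * \<nu> * real (sz z))" if \<nu>: "0 < \<nu>" "\<nu> \<le> \<nu>0" for \<nu> z
    proof -
      have "exp (2 * \<nu>) \<le> exp (ln \<rho>)" using \<nu> unfolding \<nu>0_def by simp
      then have "exp (2 * \<nu>) \<le> \<rho>" using \<rho> by simp
      then have "exp (2 * \<nu>) ^ sz z \<le> \<rho> ^ sz z" by (rule power_mono) simp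
      then have "exp (2 * \<nu> * real (sz z)) \<le> \<rho> ^ sz z" by (simp add: exp_of_nat_mult mult.commute)
      then have "norm (cf a z) * exp (2 * \<nu> * real (sz z)) \<le> norm (cf a z) * \<rho> ^ sz z"
        by (rule mult_left_mono) simp
      also have "\<dots> \<le> C" using wnorm_bound[OF \<rho>(2), of z] \<rho>(1) C by linarith
      also have "C \<le> 1 / (4 * \<nu>)"
      proof -
        have "\<nu> \<le> 1 / (4 * C)" using \<nu> unfolding \<nu>0_def by simp
        then show ?thesis using \<nu> C by (simp add: field_simps)
      qed
      finally have "norm (cf a z) \<le> 1 / (4 * \<nu>) / exp (2 * \<nu> * real (sz z))"
        by (simp only: pos_le_divide_eq exp_gt_zero)
      moreover have "exp (- 2 * \<nu> * real (sz z)) = inverse (exp (2 * \<nu> * real (sz z)))"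
        by (simp flip: exp_minus)
      ultimately show ?thesis by (simp only: divide_inverse)
    qed
    ultimately show ?thesis by blast
  qed
  then obtain f where f: "\<And>a. 0 < f a" "\<And>a \<nu> z. 0 < \<nu> \<Longrightarrow> \<nu> \<le> f a \<Longrightarrow> norm (cf a z) \<le> (1 / (4 * \<nu>)) * exp (- 2 * \<nu> * real (sz z))"
    by metis
  define \<nu>0 where "\<nu>0 = Min (range (\<lambda>(i,j). f (p $ i $ j)))"
  have \<nu>0: "\<nu>0 \<le> f (p $ i $ j)" for i j unfolding \<nu>0_def by (rule Min_le) auto
  have "short_range \<nu> (ker p)" if \<nu>: "0 < \<nu>" "\<nu> \<le> \<nu>0" for \<nu>
    unfolding short_range_def
  proof (intro conjI allI bounded_kernel_ker selfadjoint_ker assms)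
    fix x y
    have "norm (ker p x y) \<le> dom p (x - y)" by (rule norm_ker_le)
    also have "\<dots> \<le> (\<Sum>i\<in>(UNIV::2 set). \<Sum>j\<in>(UNIV::2 set). (1 / (4 * \<nu>)) * exp (- 2 * \<nu> * real (sz (x - y))))"
      unfolding dom_def by (intro sum_mono f(2) \<nu>(1) order_trans[OF \<nu>(2) \<nu>0])
    finally show "norm (ker p x y) \<le> (1 / \<nu>) * exp (- 2 * \<nu> * real (l1dist x y))"
      by (simp add: l1dist_eq_sz)
  qed
  moreover have "0 < \<nu>0" unfolding \<nu>0_def by (subst Min_gr_iff) (auto simp: f(1))
  ultimately show ?thesis using that by blast
qed

section \<open>A flat Chern insulator\<close>

text \<open>Scalars enter as multiples of the unit sequence, so that the identities below are
  identities in the ring \<open>expseq\<close>.\<close>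

definition imu :: expseq where "imu = single \<i> 0"
definition half :: expseq where "half = single (1/2) 0"
definition cos1 :: expseq where "cos1 = single (1/2) (1,0) + single (1/2) (-1,0)"
definition cos2 :: expseq where "cos2 = single (1/2) (0,1) + single (1/2) (0,-1)"
definition sin1 :: expseq where "sin1 = single (- \<i>/2) (1,0) + single (\<i>/2) (-1,0)"
definition sin2 :: expseq where "sin2 = single (- \<i>/2) (0,1) + single (\<i>/2) (0,-1)"

section \<open>Trigonometric identities\<close>

lemma single_0 [simp]: "single 0 z = 0"
  by (rule expseq_eqI) (simp add: cf_single)

lemma imu_imu: "imu * imu = - 1"
  unfolding imu_def single_mult by (rule expseq_eqI) (simp add: cf_single cf_one)

lemma imu_simps: "imu * imu = - 1" "imu * (imu * a) = - a"
  using imu_imu by (simp_all flip: mult.assoc)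

lemma two_half: "half + half = 1"
  unfolding half_def single_add by (simp add: single_one)

lemma D_scalars [simp]: "D1 imu = 0" "D2 imu = 0" "D1 half = 0" "D2 half = 0"
  unfolding imu_def half_def D_single by simp_all

lemma D_trig:
  "D1 cos1 = imu * sin1" "D2 cos1 = 0" "D1 sin1 = - (imu * cos1)" "D2 sin1 = 0"
  "D2 cos2 = imu * sin2" "D1 cos2 = 0" "D2 sin2 = - (imu * cos2)" "D1 sin2 = 0"
  unfolding cos1_def cos2_def sin1_def sin2_def imu_def D_plus D_single distrib_left single_mult
  by (auto intro!: expseq_eqI simp: cf_single)

lemma star_trig:
  "star cos1 = cos1" "star cos2 = cos2" "star sin1 = sin1" "star sin2 = sin2"
  "star half = half" "star imu = - imu"
  unfolding cos1_def cos2_def sin1_def sin2_def imu_def half_def star_plus star_single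
  by (auto intro!: expseq_eqI simp: cf_single)

text \<open>The symbols \<open>cos (2 k1)\<close> and \<open>cos (2 k2)\<close>; squares are
  linearised through them, which separates their mean from their oscillation.\<close>

definition dbl1 :: expseq where "dbl1 = single (1/2) (2,0) + single (1/2) (-2,0)"
definition dbl2 :: expseq where "dbl2 = single (1/2) (0,2) + single (1/2) (0,-2)"

lemma cf_double: "cf (2 * a) x = 2 * cf a x"
  by (simp only: mult_2 cf_plus)

lemma cos_squared: "cos1 * cos1 = half * (1 + dbl1)" "cos2 * cos2 = half * (1 + dbl2)"
  unfolding cos1_def cos2_def dbl1_def dbl2_def half_def distrib_left distrib_right mult_1_right single_mult
  by (rule expseq_eqI, simp only: cf_plus cf_single, auto simp: zero_prod_def cf_double cf_single)+

lemma sin_squared: "sin1 * sin1 = half * (1 - dbl1)" "sin2 * sin2 = half * (1 - dbl2)"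
  unfolding sin1_def sin2_def dbl1_def dbl2_def half_def distrib_left distrib_right right_diff_distrib mult_1_right single_mult
  by (rule expseq_eqI, simp only: cf_plus cf_minus cf_single, auto simp: zero_prod_def cf_double cf_single)+

lemma pythagoras: "cos1 * cos1 + sin1 * sin1 = 1" "cos2 * cos2 + sin2 * sin2 = 1"
  unfolding cos_squared sin_squared using two_half by (simp_all add: algebra_simps)

section \<open>Roots of the squared length\<close>

definition fluct :: expseq where
  "fluct = single (1/5) 0 * (dbl1 + dbl2 + dbl1 * dbl2)"

text \<open>By the double-angle formula \<open>1 + (1 + cos (2 k1)) (1 + cos (2 k2)) / 4\<close> has
  mean 5/4. Dividing by the mean leaves three terms with coefficient 1/5, of total l1 norm
  3/5.\<close>

lemma one_plus_fluct: "1 + cos1 * cos1 * (cos2 * cos2) = single (5/4) 0 * (1 + fluct)"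
proof -
  have e: "single (5/4) 0 * single (1/5) 0 = half * half" "single (5/4) 0 = 1 + half * half"
    unfolding half_def single_mult by (auto intro!: expseq_eqI simp: cf_single cf_one)
  have "single (5/4) 0 * (1 + fluct) = single (5/4) 0 + (single (5/4) 0 * single (1/5) 0) * (dbl1 + dbl2 + dbl1 * dbl2)"
    unfolding fluct_def by (simp only: distrib_left mult.assoc mult_1_right)
  also have "\<dots> = 1 + half * half * (1 + dbl1 + dbl2 + dbl1 * dbl2)"
    unfolding e(1) unfolding e(2) by (simp add: algebra_simps)
  finally show ?thesis unfolding cos_squared by (simp add: algebra_simps)
qed

text \<open>The l1 norm 3/5 leaves room for a weight above 1. At 11/10 each double-angle cosine has
  norm 121/100, and the total stays below 0.78.\<close>

lemma fluct_convergent: "(1::real) < 11/10" "wsum (11/10) (cf fluct)" "wnorm (11/10) (cf fluct) < 1"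
proof -
  let ?r = "11/10 :: real"
  have r: "0 \<le> ?r" "1 \<le> ?r" by auto
  have w1: "wsum ?r (cf dbl1)" "wnorm ?r (cf dbl1) \<le> 121/100"
    and w2: "wsum ?r (cf dbl2)" "wnorm ?r (cf dbl2) \<le> 121/100"
    unfolding dbl1_def dbl2_def
    using wsum_cf_add[of ?r "single (1/2) (2,0)" "single (1/2) (-2,0)"]
      wsum_cf_add[of ?r "single (1/2) (0,2)" "single (1/2) (0,-2)"]
    by (simp_all add: wnorm_single sz_def power2_eq_square)
  have w12: "wsum ?r (cf (dbl1 * dbl2))" "wnorm ?r (cf (dbl1 * dbl2)) \<le> 121/100 * (121/100)"
    using wsum_cf_times[OF w1(1) w2(1) r(2)] mult_mono[OF w1(2) w2(2)] wnorm_nonneg[OF r(1)]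
    by (auto intro: order_trans)
  have w3: "wsum ?r (cf (dbl1 + dbl2))" "wnorm ?r (cf (dbl1 + dbl2)) \<le> 121/100 + 121/100"
    using wsum_cf_add[OF w1(1) w2(1) r(1)] w1(2) w2(2) by auto
  have w4: "wsum ?r (cf (dbl1 + dbl2 + dbl1 * dbl2))"
    "wnorm ?r (cf (dbl1 + dbl2 + dbl1 * dbl2)) \<le> 121/100 + 121/100 + 121/100 * (121/100)"
    using wsum_cf_add[OF w3(1) w12(1) r(1)] w3(2) w12(2) by auto
  note w5 = wsum_cf_times[OF wsum_single w4(1) r(2), of "1/5" 0]
  show "1 < ?r" by simp
  show "wsum ?r (cf fluct)" unfolding fluct_def by (rule w5)
  show "wnorm ?r (cf fluct) < 1" unfolding fluct_def using w5(2) w4(2) by (simp add: wnorm_single)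
qed

text \<open>The inverse fourth root of \<open>1 + cos\<^sup>2 k1 cos\<^sup>2 k2\<close>. The unit vector needs only its square, but with
  the fourth root at hand the curvature becomes a sum of squares of self-adjoint sequences.\<close>

definition root4 :: expseq where
  "root4 = single (of_real (sqrt (sqrt (4/5)))) 0 * binser fluct (- 1/4)"

lemma star_fluct: "star fluct = fluct"
  unfolding fluct_def dbl1_def dbl2_def star_times star_plus star_single
  by (simp add: add_ac)

lemma star_root4: "star root4 = root4"
  unfolding root4_def star_times star_binser[OF fluct_convergent star_fluct] star_single by simp

text \<open>Four factors of exponent -1/4 meet one of exponent 1, so the exponents add up to 0; the
  scalars \<open>sqrt (sqrt (4/5))\<close> multiply to 4/5 and cancel the mean 5/4.\<close>

lemma root4_inverse: "root4 * root4 * (root4 * root4) * (1 + cos1 * cos1 * (cos2 * cos2)) = 1"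
proof -
  let ?k = "single (of_real (sqrt (sqrt (4/5)))) 0" and ?b = "binser fluct (- 1/4)"
  note bm = binser_mult[OF fluct_convergent]
  have k: "?k * ?k * (?k * ?k) = single (4/5) 0"
    unfolding single_mult of_real_mult[symmetric] by simp
  have b: "?b * ?b * (?b * ?b) * (1 + fluct) = 1"
    unfolding binser_1[OF fluct_convergent, symmetric] bm by (simp add: binser_0[OF fluct_convergent])
  have "root4 * root4 * (root4 * root4) * (1 + cos1 * cos1 * (cos2 * cos2))
     = ?k * ?k * (?k * ?k) * single (5/4) 0 * (?b * ?b * (?b * ?b) * (1 + fluct))"
    unfolding one_plus_fluct root4_def by (simp only: mult_ac)
  also have "\<dots> = 1" unfolding k b unfolding single_mult by (simp add: single_one)
  finally show ?thesis .
qed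

section \<open>Pauli projections and their curvature\<close>

definition pauli :: "expseq \<Rightarrow> expseq \<Rightarrow> expseq \<Rightarrow> symbol" where
  "pauli n1 n2 n3 = (\<chi> i j. half *
     (if i = 1 then if j = 1 then 1 - n3 else - (n1 - imu * n2) else if j = 1 then - (n1 + imu * n2) else 1 + n3))"

lemma pauli_nth [simp]:
  "pauli n1 n2 n3 $ 1 $ 1 = half * (1 - n3)" "pauli n1 n2 n3 $ 1 $ 2 = half * (- (n1 - imu * n2))"
  "pauli n1 n2 n3 $ 2 $ 1 = half * (- (n1 + imu * n2))" "pauli n1 n2 n3 $ 2 $ 2 = half * (1 + n3)"
  by (simp_all add: pauli_def)

lemma star_uminus: "star (- a) = - star a"
  by (rule expseq_eqI) (simp add: cf_star)

text \<open>For a unit vector n the matrix n.\<tau> squares to 1, and \<open>pauli\<close> projects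
  onto its eigenvalue -1, so that \<open>flat\<close> gives back n.\<tau>. The square is checked
  entry by entry.\<close>

lemma projection_pauli:
  assumes "star n1 = n1" "star n2 = n2" "star n3 = n3" and n: "n1 * n1 + n2 * n2 + n3 * n3 = 1"
  shows "projection_symbol (pauli n1 n2 n3)"
  unfolding projection_symbol_def
proof
  show "hermitian (pauli n1 n2 n3)"
    unfolding hermitian_def forall_2 pauli_nth
    by (simp add: star_times star_trig star_minus star_plus star_uminus star_one assms algebra_simps)
  \<comment> \<open>Halving is expressed in the ring by \<open>half + half = 1\<close>; this rule
    packages it for the four entries.\<close>
  have dbl: "half * half * x + half * half * x = half * x" for x
    using two_half by (metis distrib_left distrib_right mult.assoc mult_1_right)
  have "half * (1 - n3) * (half * (1 - n3)) + half * (- (n1 - imu * n2)) * (half * (- (n1 + imu * n2)))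
    = half * half * (1 - n3 - n3 + (n1 * n1 + n2 * n2 + n3 * n3))"
    by (simp add: algebra_simps imu_simps)
  also have "\<dots> = half * half * (1 - n3) + half * half * (1 - n3)"
    unfolding n by (simp add: algebra_simps)
  finally have "half * (1 - n3) * (half * (1 - n3)) + half * (- (n1 - imu * n2)) * (half * (- (n1 + imu * n2))) = half * (1 - n3)"
    unfolding dbl .
  moreover have "half * (1 - n3) * (half * x) + half * x * (half * (1 + n3)) = half * x" for x
  proof -
    have "half * (1 - n3) * (half * x) + half * x * (half * (1 + n3)) = half * half * x + half * half * x"
      by (simp add: algebra_simps)
    then show ?thesis unfolding dbl .
  qed
  moreover have "half * x * (half * (1 - n3)) + half * (1 + n3) * (half * x) = half * x" for x
  proof -
    have "half * x * (half * (1 - n3)) + half * (1 + n3) * (half * x) = half * half * x + half * half * x"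
      by (simp add: algebra_simps)
    then show ?thesis unfolding dbl .
  qed
  moreover have "half * (- (n1 + imu * n2)) * (half * (- (n1 - imu * n2))) + half * (1 + n3) * (half * (1 + n3))
    = half * half * (1 + n3 + n3 + (n1 * n1 + n2 * n2 + n3 * n3))"
    by (simp add: algebra_simps imu_simps)
  then have "half * (- (n1 + imu * n2)) * (half * (- (n1 - imu * n2))) + half * (1 + n3) * (half * (1 + n3))
    = half * half * (1 + n3) + half * half * (1 + n3)"
    unfolding n by (simp add: algebra_simps)
  then have "half * (- (n1 + imu * n2)) * (half * (- (n1 - imu * n2))) + half * (1 + n3) * (half * (1 + n3)) = half * (1 + n3)"
    unfolding dbl .
  ultimately show "pauli n1 n2 n3 ** pauli n1 n2 n3 = pauli n1 n2 n3"
    unfolding vec_eq_iff forall_2 matrix_matrix_mult_def vec_lambda_beta sum_2 pauli_nth by simp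
qed

lemma D_uminus: "D1 (- a) = - D1 a" "D2 (- a) = - D2 a"
  by (rule expseq_eqI, simp add: cf_D1 cf_D2)+

text \<open>The commutator of a.\<tau> and b.\<tau> is 2i times the cross product, and the trace
  against 1 - n.\<tau> picks out the triple product. An abstract ring keeps the variables atomic for
  the simplifier.\<close>

lemma pauli_trace_identity:
  fixes n1 n2 n3 a1 a2 a3 b1 b2 b3 i :: "'a::comm_ring_1"
  assumes "i * i = - 1"
  defines "p11 \<equiv> 1 - n3" and "p12 \<equiv> - (n1 - i * n2)" and "p21 \<equiv> - (n1 + i * n2)" and "p22 \<equiv> 1 + n3"
    and "q11 \<equiv> - a3" and "q12 \<equiv> - (a1 - i * a2)" and "q21 \<equiv> - (a1 + i * a2)" and "q22 \<equiv> a3"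
    and "r11 \<equiv> - b3" and "r12 \<equiv> - (b1 - i * b2)" and "r21 \<equiv> - (b1 + i * b2)" and "r22 \<equiv> b3"
  shows "p11 * (q11 * r11 - r11 * q11 + (q12 * r21 - r12 * q21))
       + p12 * (q21 * r11 - r21 * q11 + (q22 * r21 - r22 * q21))
       + (p21 * (q11 * r12 - r11 * q12 + (q12 * r22 - r12 * q22))
       + p22 * (q21 * r12 - r21 * q12 + (q22 * r22 - r22 * q22)))
     = - (4 * i * (n1 * (a2 * b3 - a3 * b2) + n2 * (a3 * b1 - a1 * b3) + n3 * (a1 * b2 - a2 * b1)))"
proof -
  have "i * (i * x) = - x" for x using assms(1) by (simp flip: mult.assoc)
  then show ?thesis unfolding assms(2-) using assms(1) by (simp add: algebra_simps)
qed

text \<open>The curvature is the triple product of n and its two derivatives, the pulled-back area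
  form of the sphere. The constant arises from three factors \<open>half\<close> against the 4 of
  the trace.\<close>

lemma chern_pauli:
  "chern (pauli n1 n2 n3) = - (half * imu * (n1 * (D1 n2 * D2 n3 - D1 n3 * D2 n2)
     + n2 * (D1 n3 * D2 n1 - D1 n1 * D2 n3) + n3 * (D1 n1 * D2 n2 - D1 n2 * D2 n1)))"
  (is "_ = - (half * imu * ?det)")
proof -
  have pull: "half * p * (half * q * (half * r) - half * r' * (half * q')) = half * half * half * (p * (q * r - r' * q'))"
    for p q r q' r' by (simp add: algebra_simps)
  have "half * half * half * 4 = (half + half) * (half + half) * half"
    by (simp add: algebra_simps)
  then have h4: "half * half * half * 4 = half" by (simp add: two_half)
  have h: "half * half * half * (- (4 * imu * d)) = - (half * imu * d)" for d
    using arg_cong[OF h4, of "\<lambda>h. - (h * imu * d)"] by (simp add: mult_ac)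
  have "chern (pauli n1 n2 n3) = half * half * half * (- (4 * imu * ?det))"
    unfolding chern_def sum_2 pauli_nth D_times D_scalars D_uminus D_plus D_minus D_one
      mult_zero_left add_0_left diff_0
    unfolding pull unfolding distrib_left[symmetric]
    unfolding pauli_trace_identity[OF imu_imu] ..
  then show ?thesis unfolding h .
qed

text \<open>A triple product is a determinant with rows n, \<open>D1\<close> n, \<open>D2\<close> n.
  If n is \<open>r\<close> times h, the derivatives of \<open>r\<close> only add multiples of the
  first row, so \<open>r\<close> enters as its cube and its derivatives drop out.\<close>

lemma det_times:
  fixes h1 h2 h3 r a1 a2 a3 b1 b2 b3 a b :: "'a::comm_ring_1"
  shows "h1 * r * ((a2 * r + h2 * a) * (b3 * r + h3 * b) - (a3 * r + h3 * a) * (b2 * r + h2 * b))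
     + h2 * r * ((a3 * r + h3 * a) * (b1 * r + h1 * b) - (a1 * r + h1 * a) * (b3 * r + h3 * b))
     + h3 * r * ((a1 * r + h1 * a) * (b2 * r + h2 * b) - (a2 * r + h2 * a) * (b1 * r + h1 * b))
   = r * r * r * (h1 * (a2 * b3 - a3 * b2) + h2 * (a3 * b1 - a1 * b3) + h3 * (a1 * b2 - a2 * b1))"
  by (simp add: algebra_simps)

text \<open>The direction of \<open>(cos k1, cos k2, sin k1 sin k2)\<close>: this map covers the sphere twice, and its
  Jacobian is nonnegative everywhere, so that no cancellation can occur in the trace.\<close>

definition chern_insulator :: symbol where
  "chern_insulator = (let r = root4 * root4 in pauli (cos1 * r) (cos2 * r) (sin1 * sin2 * r))"

lemma projection_chern_insulator: "projection_symbol chern_insulator"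
  unfolding chern_insulator_def Let_def
proof (rule projection_pauli)
  show "star (cos1 * (root4 * root4)) = cos1 * (root4 * root4)"
    "star (cos2 * (root4 * root4)) = cos2 * (root4 * root4)"
    "star (sin1 * sin2 * (root4 * root4)) = sin1 * sin2 * (root4 * root4)"
    by (simp_all add: star_times star_trig star_root4)
  have s: "sin1 * sin1 = 1 - cos1 * cos1" "sin2 * sin2 = 1 - cos2 * cos2"
    using pythagoras by (simp_all add: eq_diff_eq add.commute)
  have "cos1 * (root4 * root4) * (cos1 * (root4 * root4)) + cos2 * (root4 * root4) * (cos2 * (root4 * root4))
     + sin1 * sin2 * (root4 * root4) * (sin1 * sin2 * (root4 * root4))
    = root4 * root4 * (root4 * root4) * (cos1 * cos1 + cos2 * cos2 + (sin1 * sin1) * (sin2 * sin2))"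
    by (simp add: algebra_simps)
  also have "\<dots> = root4 * root4 * (root4 * root4) * (1 + cos1 * cos1 * (cos2 * cos2))"
    unfolding s by (simp add: algebra_simps)
  finally show "cos1 * (root4 * root4) * (cos1 * (root4 * root4)) + cos2 * (root4 * root4) * (cos2 * (root4 * root4))
     + sin1 * sin2 * (root4 * root4) * (sin1 * sin2 * (root4 * root4)) = 1"
    unfolding root4_inverse .
qed

text \<open>The two derivations contribute \<open>\<i>\<^sup>2 = -1\<close>, so minus the
  determinant is \<open>sin\<^sup>2 k1 + cos\<^sup>2 k1 sin\<^sup>2 k2\<close> times the cube of
  \<open>r\<close>. As \<open>r\<close> is a square, so is its cube, and each term becomes a square
  of a self-adjoint sequence.\<close>

lemma chern_chern_insulator:
  "chern chern_insulator = half * imu *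
     ((sin1 * (root4 * root4 * root4)) * (sin1 * (root4 * root4 * root4))
      + (cos1 * sin2 * (root4 * root4 * root4)) * (cos1 * sin2 * (root4 * root4 * root4)))"
proof -
  define r where "r = root4 * root4"
  have "chern chern_insulator = - (half * imu * (r * r * r * (
      cos1 * (D1 cos2 * D2 (sin1 * sin2) - D1 (sin1 * sin2) * D2 cos2)
    + cos2 * (D1 (sin1 * sin2) * D2 cos1 - D1 cos1 * D2 (sin1 * sin2))
    + sin1 * sin2 * (D1 cos1 * D2 cos2 - D1 cos2 * D2 cos1))))"
    unfolding chern_insulator_def Let_def r_def[symmetric] chern_pauli
      D_times(1)[of cos1 r] D_times(1)[of cos2 r] D_times(1)[of "sin1 * sin2" r]
      D_times(2)[of cos1 r] D_times(2)[of cos2 r] D_times(2)[of "sin1 * sin2" r] det_times ..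
  also have "\<dots> = half * imu * (r * r * r * (sin1 * sin1 * (cos2 * cos2 + sin2 * sin2) + (cos1 * sin2) * (cos1 * sin2)))"
    unfolding D_times D_trig by (simp add: algebra_simps imu_simps)
  also have "\<dots> = half * imu * (r * r * r * (sin1 * sin1 + (cos1 * sin2) * (cos1 * sin2)))"
    unfolding pythagoras by simp
  finally show ?thesis unfolding r_def by (simp add: algebra_simps)
qed

text \<open>The zero modes \<open>A\<close> and \<open>B\<close> of the two squares are nonnegative
  and the first is nonzero; the factor \<open>\<i>\<close> of the curvature meets that of
  \<open>sigma\<close> and the value is \<open>pi * (A + B)\<close>.\<close>

lemma sigma_chern_insulator: "sigma (ker (flat chern_insulator)) 0 \<noteq> 0"
proof -
  let ?a = "sin1 * (root4 * root4 * root4)" and ?b = "cos1 * sin2 * (root4 * root4 * root4)"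
  have st: "star ?a = ?a" "star ?b = ?b" by (simp_all add: star_times star_trig star_root4)
  \<comment> \<open>\<open>root4\<close> is invertible, so \<open>?a\<close> could vanish only
    together with \<open>sin1\<close>.\<close>
  have "?a \<noteq> 0"
  proof
    assume "?a = 0"
    moreover have "?a * (root4 * (1 + cos1 * cos1 * (cos2 * cos2)))
        = sin1 * (root4 * root4 * (root4 * root4) * (1 + cos1 * cos1 * (cos2 * cos2)))"
      by (simp only: mult_ac)
    ultimately have "sin1 = 0" unfolding root4_inverse by simp
    moreover have "cf sin1 (1,0) = - \<i>/2" unfolding sin1_def by (simp add: cf_single)
    ultimately show False by simp
  qed
  then have "cf (?a * ?a) 0 \<noteq> 0" using self_mult_cf_zero_eq_0[OF st(1)] by blast
  moreover obtain A where A: "cf (?a * ?a) 0 = of_real A" "0 \<le> A"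
    using cf_zero_self_mult(1)[OF st(1)] infsum_nonneg[of UNIV "\<lambda>x. (norm (cf ?a x))\<^sup>2"] by auto
  moreover obtain B where B: "cf (?b * ?b) 0 = of_real B" "0 \<le> B"
    using cf_zero_self_mult(1)[OF st(2)] infsum_nonneg[of UNIV "\<lambda>x. (norm (cf ?b x))\<^sup>2"] by auto
  ultimately have AB: "A + B > 0" by auto
  have c: "cf (chern chern_insulator) 0 = 1/2 * (\<i> * (of_real A + of_real B))"
    unfolding chern_chern_insulator half_def imu_def mult.assoc[of "single _ _"] cf_single_0_times cf_plus A(1) B(1) ..
  then have "sigma (ker (flat chern_insulator)) 0 = of_real (pi * (A + B))"
    unfolding sigma_flat[OF projection_chern_insulator] c by (simp add: algebra_simps)
  then show ?thesis using AB by (simp only: of_real_eq_0_iff) simp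
qed

lemma projection_zero: "projection_symbol 0"
  unfolding projection_symbol_def hermitian_def by (simp add: star_zero)

lemma flat_zero: "flat 0 = mat 1"
  unfolding flat_def by simp

lemma sigma_trivial: "sigma (ker (flat 0)) 0 = 0"
  unfolding sigma_flat[OF projection_zero] chern_def by simp

section \<open>The interface\<close>

text \<open>A walk in the first coordinate direction leaves the strip after a bounded number of
  steps, and the last site before the first exit lies in the boundary.\<close>

lemma strip_boundary_near:
  assumes L: "L > 0" and \<Omega>: "\<Omega> \<subseteq> {x. \<bar>real_of_int (fst x)\<bar> \<le> L}" and x: "x \<in> \<Omega>"
  shows "\<exists>z\<in>boundary \<Omega>. l1dist x z \<le> nat (2 * (\<lfloor>L\<rfloor> + 1))"
proof -
  \<comment> \<open>\<open>N\<close> exceeds \<open>L\<close>, and sites of the strip have first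
    coordinate at least \<open>- N\<close>, so \<open>2 * N\<close> steps lead out.\<close>
  define N where "N = \<lfloor>L\<rfloor> + 1"
  define far where "far m \<longleftrightarrow> (fst x + int m, snd x) \<notin> \<Omega>" for m
  have "real_of_int (- fst x) \<le> L" using x \<Omega> by auto
  then have xN: "- N \<le> fst x" unfolding N_def le_floor_iff[symmetric] by simp
  have "\<not> \<bar>real_of_int (fst x + int (nat (2 * N)))\<bar> \<le> L"
    using xN L unfolding N_def by (simp add: not_le) linarith
  then have far: "far (nat (2 * N))" using \<Omega> unfolding far_def by auto
  define m where "m = (LEAST m. far m)"
  have m: "far m" "m \<le> nat (2 * N)" unfolding m_def using far by (auto intro: LeastI Least_le)
  have "m \<noteq> 0" using m(1) x unfolding far_def by (metis add_0_right of_nat_0 prod.collapse)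
  then obtain k where k: "m = Suc k" using not0_implies_Suc by blast
  then have "\<not> far k" unfolding m_def using not_less_Least by (metis lessI)
  then have "(fst x + int k, snd x) \<in> \<Omega>" unfolding far_def by simp
  moreover have "(fst x + int m, snd x) \<notin> \<Omega>" using m(1) unfolding far_def .
  moreover have "l1dist (fst x + int k, snd x) (fst x + int m, snd x) \<le> 1" by (simp add: l1dist_def k)
  ultimately have "(fst x + int k, snd x) \<in> boundary \<Omega>" unfolding boundary_def by blast
  moreover have "l1dist x (fst x + int k, snd x) \<le> nat (2 * N)"
    using m(2) k unfolding l1dist_def by simp
  ultimately show ?thesis unfolding N_def by blast
qed

lemma dist_bound_nonneg: "0 < \<nu> \<Longrightarrow> 0 \<le> dist_bound \<nu> x S"
  unfolding dist_bound_def by simp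

text \<open>Off the set the error vanishes because \<open>Hm\<close> couples no distinct sites. On
  it the error is at most \<open>C\<close>, and the boundary is near enough for the exponential to
  stay above 1/3, so the prefactor \<open>1/\<nu>\<close> covers the rest.\<close>

lemma assumption2_trivial_edge:
  fixes \<nu> :: real
  assumes L: "L > 0" and \<Omega>: "\<Omega> \<subseteq> {x. \<bar>real_of_int (fst x)\<bar> \<le> L}"
    and C: "\<And>x y. norm (Hp x y) + norm (Hm x y) \<le> C"
    and diag: "\<And>x y. x \<noteq> y \<Longrightarrow> Hm x y = 0"
    and sr: "short_range \<nu> Hm" and \<nu>: "0 < \<nu>" "3 * C * \<nu> \<le> 1" "4 * (\<lfloor>L\<rfloor> + 1) * \<nu> \<le> 1"
  shows "assumption2 \<nu> \<Omega> Hp Hm Hm"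
  unfolding assumption2_def
proof (intro conjI allI sr)
  fix x y
  show "norm (edge_error \<Omega> Hp Hm Hm x y) \<le> dist_bound \<nu> x (boundary \<Omega>)"
  proof (cases "x \<in> \<Omega>")
    case False
    then have "edge_error \<Omega> Hp Hm Hm x y = 0" using diag[of x y] by (auto simp: edge_error_def)
    then show ?thesis using dist_bound_nonneg[OF \<nu>(1)] by simp
  next
    case True
    obtain z where z: "z \<in> boundary \<Omega>" "l1dist x z \<le> nat (2 * (\<lfloor>L\<rfloor> + 1))"
      using strip_boundary_near[OF L \<Omega> True] by blast
    have "(INF z\<in>boundary \<Omega>. l1dist x z) \<le> l1dist x z"
      by (rule cINF_lower[OF _ z(1)]) simp
    also note z(2)
    finally have "(INF z\<in>boundary \<Omega>. l1dist x z) \<le> nat (2 * (\<lfloor>L\<rfloor> + 1))" .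
    then have "real (INF z\<in>boundary \<Omega>. l1dist x z) \<le> 2 * (\<lfloor>L\<rfloor> + 1)"
      using L by (simp add: le_nat_iff)
    then have "2 * \<nu> * real (INF z\<in>boundary \<Omega>. l1dist x z) \<le> 2 * \<nu> * (2 * (\<lfloor>L\<rfloor> + 1))"
      using \<nu>(1) by (intro mult_left_mono) auto
    then have "- 2 * \<nu> * real (INF z\<in>boundary \<Omega>. l1dist x z) \<ge> - 1"
      using \<nu>(3) by (simp add: algebra_simps)
    then have "exp (- 1) \<le> exp (- 2 * \<nu> * real (INF z\<in>boundary \<Omega>. l1dist x z))" by simp
    \<comment> \<open>The bound of e by 3 is the origin of the 3 in
      \<open>3 * C * \<nu> \<le> 1\<close>.\<close>
    moreover have "1/3 \<le> exp (- 1 :: real)" using exp_le by (simp add: exp_minus field_simps)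
    ultimately have "1/3 \<le> exp (- 2 * \<nu> * real (INF z\<in>boundary \<Omega>. l1dist x z))" by linarith
    then have "1/\<nu> * (1/3) \<le> 1/\<nu> * exp (- 2 * \<nu> * real (INF z\<in>boundary \<Omega>. l1dist x z))"
      using \<nu>(1) by (intro mult_left_mono) auto
    moreover have "C \<le> 1/\<nu> * (1/3)" using \<nu> by (simp add: field_simps)
    moreover have "norm (edge_error \<Omega> Hp Hm Hm x y) \<le> C"
    proof (cases "y \<in> \<Omega>")
      case y: True
      then have "norm (edge_error \<Omega> Hp Hm Hm x y) \<le> norm (Hm x y) + norm (Hp x y)"
        using True norm_triangle_ineq4 by (simp add: edge_error_def)
      then show ?thesis using C[of x y] by linarith
    next
      case y: False
      then have "edge_error \<Omega> Hp Hm Hm x y = 0" using True diag[of x y] by (auto simp: edge_error_def)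
      then show ?thesis using C[of x y] norm_ge_zero[of "Hp x y"] norm_ge_zero[of "Hm x y"] by (simp only: norm_zero)
    qed
    \<comment> \<open>\<open>z\<close> also shows that the boundary is nonempty, which excludes the
      value 0 that \<open>dist_bound\<close> takes on the empty set.\<close>
    ultimately show ?thesis using z(1) unfolding dist_bound_def by auto
  qed
qed

theorem theorem3:
  fixes L :: real and \<Omega> :: "(int \<times> int) set"
  assumes "L > 0" and "\<Omega> \<subseteq> {x. \<bar>real_of_int (fst x)\<bar> \<le> L}"
  shows "\<exists>\<nu> Hp Hm G He. 0 < \<nu> \<and> \<nu> \<le> 1 \<and> assumption1 \<nu> Hp Hm G \<and> (0::real) \<in> G \<and>
           assumption2 \<nu> \<Omega> Hp Hm He \<and> (0::complex) \<notin> spectrum_k He"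
proof -
  define Hp where "Hp = ker (flat chern_insulator)"
  define Hm where "Hm = ker (flat 0)"
  have herm: "hermitian (flat chern_insulator)" "hermitian (flat 0)"
    using projection_chern_insulator projection_zero by (auto simp: projection_symbol_def hermitian_flat)
  obtain \<nu>p where \<nu>p: "0 < \<nu>p" "\<And>\<nu>. 0 < \<nu> \<Longrightarrow> \<nu> \<le> \<nu>p \<Longrightarrow> short_range \<nu> Hp"
    using short_range_flat[OF herm(1)] unfolding Hp_def by blast
  obtain \<nu>m where \<nu>m: "0 < \<nu>m" "\<And>\<nu>. 0 < \<nu> \<Longrightarrow> \<nu> \<le> \<nu>m \<Longrightarrow> short_range \<nu> Hm"
    using short_range_flat[OF herm(2)] unfolding Hm_def by blast
  \<comment> \<open>Taken at its own threshold, each short-range bound limits the kernel uniformly,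
    so \<open>C\<close> does not depend on the \<nu> chosen below.\<close>
  define C where "C = 1/\<nu>p + 1/\<nu>m"
  have C0: "0 < C" unfolding C_def using \<nu>p(1) \<nu>m(1) by (simp add: add_pos_pos)
  have bound: "norm (K x y) \<le> 1/\<nu>" if "short_range \<nu> K" "0 < \<nu>" for \<nu> K x y
  proof -
    have "norm (K x y) \<le> (1/\<nu>) * exp (- 2 * \<nu> * real (l1dist x y))"
      using that(1) unfolding short_range_def by blast
    also have "\<dots> \<le> (1/\<nu>) * 1" using that(2) by (intro mult_left_mono) auto
    finally show ?thesis by simp
  qed
  have C: "norm (Hp x y) + norm (Hm x y) \<le> C" for x y
    unfolding C_def using bound[OF \<nu>p(2)[OF \<nu>p(1)] \<nu>p(1)] bound[OF \<nu>m(2)[OF \<nu>m(1)] \<nu>m(1)]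
    by (simp add: add_mono)
  define N where "N = 4 * (real_of_int \<lfloor>L\<rfloor> + 1)"
  have "0 \<le> real_of_int \<lfloor>L\<rfloor>" using assms(1) by simp
  then have N: "0 < N" unfolding N_def by (intro mult_pos_pos add_nonneg_pos) simp_all
  \<comment> \<open>The entries secure in turn the range of \<nu>, the two short-range bounds, the
    size of the error and the distance to the boundary.\<close>
  define \<nu> where "\<nu> = Min {1, \<nu>p, \<nu>m, 1 / (3 * C), 1 / N}"
  have \<nu>: "0 < \<nu>" "\<nu> \<le> 1" "\<nu> \<le> \<nu>p" "\<nu> \<le> \<nu>m" "\<nu> \<le> 1 / (3 * C)" "\<nu> \<le> 1 / N"
    unfolding \<nu>_def using \<nu>p(1) \<nu>m(1) C0 N by (auto simp: Min_gr_iff)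
  have sp: "0 \<notin> spectrum_k Hp" "0 \<notin> spectrum_k Hm"
    unfolding Hp_def Hm_def by (intro flat_not_in_spectrum projection_chern_insulator projection_zero)+
  \<comment> \<open>The gap interval is the single point 0, so \<sigma> is compared at one
    energy.\<close>
  have "assumption1 \<nu> Hp Hm {0}"
    unfolding assumption1_def using \<nu>p(2) \<nu>m(2) \<nu> sp sigma_chern_insulator sigma_trivial
    by (simp add: is_interval_1 Hp_def Hm_def)
  moreover have "assumption2 \<nu> \<Omega> Hp Hm Hm"
  proof (rule assumption2_trivial_edge[OF assms C])
    show "Hm x y = 0" if "x \<noteq> y" for x y using that unfolding Hm_def flat_zero ker_mat_1 by simp
    show "3 * C * \<nu> \<le> 1" using \<nu>(5) C0 by (simp add: field_simps)
    show "4 * (\<lfloor>L\<rfloor> + 1) * \<nu> \<le> 1" using \<nu>(6) N by (simp add: N_def field_simps)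
  qed (use \<nu> \<nu>m(2) in auto)
  ultimately show ?thesis using \<nu>(1,2) sp(2) by blast
qed

end
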